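(* (1) Every centric hexagon $\mathcal H$ of $\hat{\mathcal X}$ with center $n_0$ is of the form $\mathcal H=S\setminus H_0$ (with the induced subgraph of $\hat\Gamma$), where $S\subseteq Q$ is such that $Q(S)$ is an $\mathbb F_2$-subgeometry of $Q$ isomorphic to $Q^+(3,2)$ and $n_0\in\langle S\rangle_{\mathbb F_2}$. (2) Every centric cube $C$ of $\hat{\mathcal X}$ with center $n_0$ is of the form $C=S\setminus H_0$, where $Q(S)$ is an $\mathbb F_2$-subgeometry of $Q$ isomorphic to $Q(4,2)$ and $n_0\in\langle S\rangle_{\mathbb F_2}$. (3) Every centric dodecade $D$ of $\hat{\mathcal X}$ with center $n_0$ is of the form $D=S\setminus H_0$, where $Q(S)$ is an $\mathbb F_2$-subgeometry of $Q$ isomorphic to $Q^-(5,2)$ and $n_0\in\langle S\rangle_{\mathbb F_2}$.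
   Context: Let $q=2^n$, $V=V(6,q)$, and let $Q=Q^-(5,q)$ be the set of singular points of a non-degenerate quadratic form $f$ of Witt index $2$ on $V$, a generalized quadrangle of order $(q,q^2)$ whose lines are the totally singular lines; $\perp$ is the polarity defined by the bilinear form of $f$. Let $H_0$ be a hyperplane with $Q_0:=Q\cap H_0\cong Q(4,q)$ parabolic, and $n_0:=H_0^\perp$ (so $H_0=n_0^\perp$). $\hat{\mathcal X}$ is the geometry with points $Q\setminus Q_0$ and lines $l\setminus\{l\cap Q_0\}$ for lines $l$ of $Q$ not in $Q_0$; $\hat\Gamma$ is its collinearity graph. For $k\ge3$, a centric $2k$-configuration of $\hat{\mathcal X}$ with center $n_0$ is a set of $2k$ points $\{x_i^a: i=1,\dots,k,\ a=1,2\}$ of $Q\setminus Q_0$ such that $x_i^a,x_j^b$ are adjacent in $\hat\Gamma$ iff $i\ne j$ and $a\ne b$, and each projective line through $x_i^1,x_i^2$ passes through $n_0$; it is a centric hexagon, cube, dodecade for $k=3,4,6$. For $S\subseteq\mathrm{PG}(V)$, there is a unique smallest subfield $\mathbb F_S$ of $\mathbb F_q$ such that $S$ is contained in a projective subgeometry of $\mathrm{PG}(V)$ defined over $\mathbb F_S$ (the set of points, in some subspace, admitting coordinates in $\mathbb F_S$ with respect to a suitable basis), and among such subgeometries there is a smallest one, denoted $\langle S\rangle_{\mathbb F_S}$. For $S\subseteq Q$, $Q(S)$ is the point-line geometry with point set $S$ and lines the sets $l\cap S$, $l$ a line of $Q$ with $|l\cap S|\ge2$; $Q(S)$ is an $\mathbb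 F_2$-subgeometry if $\mathbb F_S=\mathbb F_2$. $Q^+(3,2)$, $Q(4,2)$, $Q^-(5,2)$ denote the classical generalized quadrangles of orders $(2,1)$, $(2,2)$, $(2,4)$. *)

theory Defs
  imports Main "HOL-Library.Z2"
begin

definition vecs :: "nat \<Rightarrow> (nat \<Rightarrow> 'a::field) set" where
  "vecs d = {v. \<forall>i\<ge>d. v i = 0}"

definition lin_comb :: "nat \<Rightarrow> (nat \<Rightarrow> 'a::field) \<Rightarrow> (nat \<Rightarrow> nat \<Rightarrow> 'a) \<Rightarrow> (nat \<Rightarrow> 'a)" where
  "lin_comb m c e = (\<lambda>j. \<Sum>i<m. c i * e i j)"

definition lin_indep :: "nat \<Rightarrow> (nat \<Rightarrow> nat \<Rightarrow> 'a::field) \<Rightarrow> bool" where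
  "lin_indep m e \<longleftrightarrow> (\<forall>c. lin_comb m c e = (\<lambda>_. 0) \<longrightarrow> (\<forall>i<m. c i = 0))"

definition pt :: "(nat \<Rightarrow> 'a::field) \<Rightarrow> (nat \<Rightarrow> 'a) set" where
  "pt v = {(\<lambda>j. c * v j) | c. True}"

definition proj_points :: "nat \<Rightarrow> ((nat \<Rightarrow> 'a::field) set) set" where
  "proj_points d = {pt v | v. v \<in> vecs d \<and> v \<noteq> (\<lambda>_. 0)}"

definition proj_span :: "nat \<Rightarrow> (nat \<Rightarrow> nat \<Rightarrow> 'a::field) \<Rightarrow> ((nat \<Rightarrow> 'a) set) set" where
  "proj_span m e = {pt (lin_comb m c e) | c. \<exists>i<m. c i \<noteq> 0}"

definition proj_lines :: "nat \<Rightarrow> ((nat \<Rightarrow> 'a::field) set) set set" where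
  "proj_lines d = {proj_span 2 e | e. (\<forall>i<2. e i \<in> vecs d) \<and> lin_indep 2 e}"

definition hyperplane :: "nat \<Rightarrow> ((nat \<Rightarrow> 'a::field) set) set \<Rightarrow> bool" where
  "hyperplane d H \<longleftrightarrow> (\<exists>a. (\<exists>i<d. a i \<noteq> 0) \<and>
      H = {pt v | v. v \<in> vecs d \<and> v \<noteq> (\<lambda>_. 0) \<and> (\<Sum>i<d. a i * v i) = 0})"

definition is_qform :: "nat \<Rightarrow> ((nat \<Rightarrow> 'a::field) \<Rightarrow> 'a) \<Rightarrow> bool" where
  "is_qform d f \<longleftrightarrow> (\<exists>a. \<forall>v. f v = (\<Sum>i<d. \<Sum>j\<in>{i..<d}. a i j * v i * v j))"

definition bil :: "((nat \<Rightarrow> 'a::field) \<Rightarrow> 'a) \<Rightarrow> (nat \<Rightarrow> 'a) \<Rightarrow> (nat \<Rightarrow> 'a) \<Rightarrow> 'a" where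
  "bil f u v = f (\<lambda>j. u j + v j) - f u - f v"

definition nondeg :: "nat \<Rightarrow> ((nat \<Rightarrow> 'a::field) \<Rightarrow> 'a) \<Rightarrow> bool" where
  "nondeg d f \<longleftrightarrow> (\<forall>u\<in>vecs d. (\<forall>v\<in>vecs d. bil f u v = 0) \<longrightarrow> u = (\<lambda>_. 0))"

definition tot_sing_subspace :: "nat \<Rightarrow> ((nat \<Rightarrow> 'a::field) \<Rightarrow> 'a) \<Rightarrow> nat \<Rightarrow> bool" where
  "tot_sing_subspace d f m \<longleftrightarrow>
     (\<exists>e. (\<forall>i<m. e i \<in> vecs d) \<and> lin_indep m e \<and> (\<forall>c. f (lin_comb m c e) = 0))"

definition witt_index_2 :: "nat \<Rightarrow> ((nat \<Rightarrow> 'a::field) \<Rightarrow> 'a) \<Rightarrow> bool" where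
  "witt_index_2 d f \<longleftrightarrow> tot_sing_subspace d f 2 \<and> \<not> tot_sing_subspace d f 3"

definition sing_pts :: "nat \<Rightarrow> ((nat \<Rightarrow> 'a::field) \<Rightarrow> 'a) \<Rightarrow> ((nat \<Rightarrow> 'a) set) set" where
  "sing_pts d f = {pt v | v. v \<in> vecs d \<and> v \<noteq> (\<lambda>_. 0) \<and> f v = 0}"

definition qlines :: "nat \<Rightarrow> ((nat \<Rightarrow> 'a::field) \<Rightarrow> 'a) \<Rightarrow> ((nat \<Rightarrow> 'a) set) set set" where
  "qlines d f = {l \<in> proj_lines d. l \<subseteq> sing_pts d f}"

definition perp :: "nat \<Rightarrow> ((nat \<Rightarrow> 'a::field) \<Rightarrow> 'a) \<Rightarrow> (nat \<Rightarrow> 'a) set \<Rightarrow> ((nat \<Rightarrow> 'a) set) set" where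
  "perp d f p = {x \<in> proj_points d. \<exists>v w. p = pt v \<and> x = pt w \<and> bil f v w = 0}"

definition subgeom_lines :: "nat \<Rightarrow> ((nat \<Rightarrow> 'a::field) \<Rightarrow> 'a) \<Rightarrow> ((nat \<Rightarrow> 'a) set) set
      \<Rightarrow> ((nat \<Rightarrow> 'a) set) set set" where
  "subgeom_lines d f S = {l \<inter> S | l. l \<in> qlines d f \<and> card (l \<inter> S) \<ge> 2}"

definition geom_iso :: "'p set \<Rightarrow> 'p set set \<Rightarrow> 'q set \<Rightarrow> 'q set set \<Rightarrow> bool" where
  "geom_iso P1 L1 P2 L2 \<longleftrightarrow> (\<exists>\<phi>. bij_betw \<phi> P1 P2 \<and> (\<lambda>l. \<phi> ` l) ` L1 = L2)"

definition qplus_3_2_form :: "(nat \<Rightarrow> bit) \<Rightarrow> bit" where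
  "qplus_3_2_form v = v 0 * v 1 + v 2 * v 3"

definition q_4_2_form :: "(nat \<Rightarrow> bit) \<Rightarrow> bit" where
  "q_4_2_form v = v 0 * v 1 + v 2 * v 3 + v 4 * v 4"

definition qminus_5_2_form :: "(nat \<Rightarrow> bit) \<Rightarrow> bit" where
  "qminus_5_2_form v = v 0 * v 1 + v 2 * v 3 + v 4 * v 4 + v 4 * v 5 + v 5 * v 5"

definition parabolic_form :: "(nat \<Rightarrow> 'a::field) \<Rightarrow> 'a" where
  "parabolic_form v = v 0 * v 1 + v 2 * v 3 + v 4 * v 4"

definition F2_subgeometry :: "nat \<Rightarrow> ((nat \<Rightarrow> 'a::field) set) set \<Rightarrow> bool" where
  "F2_subgeometry d G \<longleftrightarrow> (\<exists>m e. m \<le> d \<and> (\<forall>i<m. e i \<in> vecs d) \<and> lin_indep m e \<and>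
      G = {pt (lin_comb m c e) | c. (\<forall>i<m. c i \<in> {0, 1}) \<and> (\<exists>i<m. c i \<noteq> 0)})"

definition is_F2_subgeometry_set :: "nat \<Rightarrow> ((nat \<Rightarrow> 'a::field) set) set \<Rightarrow> bool" where
  "is_F2_subgeometry_set d S \<longleftrightarrow> (\<exists>G. F2_subgeometry d G \<and> S \<subseteq> G)"

definition F2_span :: "nat \<Rightarrow> ((nat \<Rightarrow> 'a::field) set) set \<Rightarrow> ((nat \<Rightarrow> 'a) set) set" where
  "F2_span d S = \<Inter> {G. F2_subgeometry d G \<and> S \<subseteq> G}"

definition hat_adj :: "((nat \<Rightarrow> 'a::field) \<Rightarrow> 'a) \<Rightarrow> ((nat \<Rightarrow> 'a) set) set
     \<Rightarrow> (nat \<Rightarrow> 'a) set \<Rightarrow> (nat \<Rightarrow> 'a) set \<Rightarrow> bool" where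
  "hat_adj f H0 x y \<longleftrightarrow> x \<noteq> y \<and>
     (\<exists>l\<in>qlines 6 f. \<not> l \<subseteq> H0 \<and> x \<in> l - H0 \<and> y \<in> l - H0)"

text \<open>x i a for i < k and a < 2 (a = 0,1 standing for 1,2)\<close>
definition centric_config :: "((nat \<Rightarrow> 'a::field) \<Rightarrow> 'a) \<Rightarrow> ((nat \<Rightarrow> 'a) set) set
     \<Rightarrow> (nat \<Rightarrow> 'a) set \<Rightarrow> nat \<Rightarrow> (nat \<Rightarrow> nat \<Rightarrow> (nat \<Rightarrow> 'a) set) \<Rightarrow> bool" where
  "centric_config f H0 n0 k x \<longleftrightarrow>
     3 \<le> k \<and>
     inj_on (\<lambda>(i, a). x i a) ({..<k} \<times> {..<2}) \<and>
     (\<forall>i<k. \<forall>a<2. x i a \<in> sing_pts 6 f - H0) \<and>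
     (\<forall>i<k. \<forall>a<2. \<forall>j<k. \<forall>b<2. hat_adj f H0 (x i a) (x j b) \<longleftrightarrow> (i \<noteq> j \<and> a \<noteq> b)) \<and>
     (\<forall>i<k. \<forall>l\<in>proj_lines 6. x i 0 \<in> l \<and> x i 1 \<in> l \<longrightarrow> n0 \<in> l)"

definition config_set :: "nat \<Rightarrow> (nat \<Rightarrow> nat \<Rightarrow> 'p) \<Rightarrow> 'p set" where
  "config_set k x = (\<lambda>(i, a). x i a) ` ({..<k} \<times> {..<2})"

end

theory Submission
  imports Defs "HOL-Library.Function_Algebras"
begin

text \<open>
  Write \<open>B\<close> for the bilinear form and \<open>n\<^sub>0 = \<langle>u\<rangle>\<close>. A pair of distinct singular points off \<open>u\<^sup>\<perp>\<close> on a
  line through \<open>n\<^sub>0\<close> forces \<open>f u \<noteq> 0\<close>, so \<open>u\<close> can be scaled to \<open>f u = 1\<close>; the pair is then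
  \<open>\<langle>y\<^sub>i\<rangle>, \<langle>y\<^sub>i + u\<rangle>\<close> with \<open>f y\<^sub>i = 0\<close> and \<open>B u y\<^sub>i = 1\<close>, and the adjacencies say \<open>B y\<^sub>i y\<^sub>j = 1\<close> for
  \<open>i \<noteq> j\<close>. Hence \<open>f\<close> takes values in the prime field on the \<open>0/1\<close>-combinations of \<open>u, y\<^sub>1, ..., y\<^sub>k\<close>,
  and \<open>S\<close> is the set of singular points among them: the form there is the standard one of type
  \<open>Q\<^sup>+(3,2)\<close>, \<open>Q(4,2)\<close>, \<open>Q\<^sup>-(5,2)\<close> for \<open>k = 3, 4, 6\<close>. For \<open>k = 6\<close> the seven vectors lie in a space of
  dimension six, and their only relation is that their sum vanishes.
\<close>

section \<open>Vectors, scalar multiples and projective points\<close>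

definition scale :: "'a::field \<Rightarrow> (nat \<Rightarrow> 'a) \<Rightarrow> nat \<Rightarrow> 'a" where
  "scale c v = (\<lambda>j. c * v j)"

lemma scale_simps [simp]:
  "scale 1 v = v" "scale 0 v = 0" "scale c 0 = 0" "scale a (scale b v) = scale (a * b) v"
  by (auto simp: scale_def fun_eq_iff mult.assoc)

lemma scale_add: "scale c (v + w) = scale c v + scale c w" "scale (a + b) v = scale a v + scale b v"
  by (auto simp: scale_def fun_eq_iff algebra_simps)

lemma scale_eq_0_iff [simp]: "scale c v = 0 \<longleftrightarrow> c = 0 \<or> v = 0"
  by (auto simp: scale_def fun_eq_iff)

lemma zero_vec: "(\<lambda>_. 0) = (0 :: nat \<Rightarrow> 'a::zero)"
  by (auto simp: fun_eq_iff)

lemma vecs_closed [simp]: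
  "0 \<in> vecs d" "v \<in> vecs d \<Longrightarrow> w \<in> vecs d \<Longrightarrow> v + w \<in> vecs d" "v \<in> vecs d \<Longrightarrow> scale c v \<in> vecs d"
  by (auto simp: vecs_def scale_def)

lemma vecs_eqI:
  assumes "c \<in> vecs m" "d \<in> vecs m" "\<And>i. i < m \<Longrightarrow> c i = d i"
  shows "c = d"
proof
  fix i show "c i = d i"
    using assms by (cases "i < m") (auto simp: vecs_def)
qed

lemma vecs_lin_comb: "(\<And>i. i < m \<Longrightarrow> e i \<in> vecs d) \<Longrightarrow> lin_comb m c e \<in> vecs d"
  by (auto simp: vecs_def lin_comb_def)

lemma lin_comb_0 [simp]: "lin_comb 0 c e = 0"
  by (auto simp: lin_comb_def)

lemma lin_comb_Suc: "lin_comb (Suc m) c e = lin_comb m c e + scale (c m) (e m)"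
  by (auto simp: lin_comb_def scale_def)

lemma pt_eq_range: "pt v = range (\<lambda>c. scale c v)"
  by (auto simp: pt_def scale_def)

lemma pt_self [simp]: "v \<in> pt v"
  unfolding pt_eq_range by (metis rangeI scale_simps(1))

lemma pt_scale [simp]: "c \<noteq> 0 \<Longrightarrow> pt (scale c v) = pt v"
proof -
  assume "c \<noteq> 0"
  then have "scale a v = scale (a / c) (scale c v)" for a
    by simp
  then show ?thesis
    unfolding pt_eq_range by (auto simp only: scale_simps)
qed

lemma pt_eqE:
  assumes "pt v = pt w" "w \<noteq> 0"
  obtains c where "c \<noteq> 0" "w = scale c v"
proof -
  have "w \<in> pt v"
    using assms(1) by simp
  then obtain c where c: "w = scale c v"
    unfolding pt_eq_range by blast
  then have "c \<noteq> 0"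
    using assms(2) by auto
  then show thesis
    using c by (rule that)
qed

section \<open>Lines spanned by two vectors\<close>

definition indep2 :: "(nat \<Rightarrow> 'a::field) \<Rightarrow> (nat \<Rightarrow> 'a) \<Rightarrow> bool" where
  "indep2 p q \<longleftrightarrow> (\<forall>a b. scale a p + scale b q = 0 \<longrightarrow> a = 0 \<and> b = 0)"

lemma indep2_iff: "indep2 p q \<longleftrightarrow> p \<noteq> 0 \<and> q \<noteq> 0 \<and> pt p \<noteq> pt q"
proof
  assume i: "indep2 p q"
  have "p \<noteq> 0"
    using i[unfolded indep2_def, rule_format, of 1 0] by auto
  moreover have "q \<noteq> 0"
    using i[unfolded indep2_def, rule_format, of 0 1] by auto
  moreover have "pt p \<noteq> pt q"
  proof
    assume "pt p = pt q"
    then obtain c where c: "q = scale c p"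
      using pt_eqE \<open>q \<noteq> 0\<close> by metis
    have "scale c p + scale (-1) q = 0"
      unfolding c by (auto simp: scale_def fun_eq_iff)
    then show False
      using i unfolding indep2_def by fastforce
  qed
  ultimately show "p \<noteq> 0 \<and> q \<noteq> 0 \<and> pt p \<noteq> pt q" by blast
next
  assume pq: "p \<noteq> 0 \<and> q \<noteq> 0 \<and> pt p \<noteq> pt q"
  show "indep2 p q"
    unfolding indep2_def
  proof (intro allI impI)
    fix a b assume s: "scale a p + scale b q = 0"
    have b: "b = 0"
    proof (rule ccontr)
      assume "b \<noteq> 0"
      have q: "q = scale (- a / b) p"
      proof
        fix j
        have "a * p j + b * q j = 0"
          using s by (auto simp: scale_def fun_eq_iff)
        then show "q j = scale (- a / b) p j"
          using \<open>b \<noteq> 0\<close> by (simp add: scale_def field_simps add_eq_0_iff)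
      qed
      have "- a / b \<noteq> 0"
        using pq q by auto
      then have "pt q = pt p"
        unfolding q by (rule pt_scale)
      then show False
        using pq by simp
    qed
    then show "a = 0 \<and> b = 0"
      using s pq by auto
  qed
qed

text \<open>Two named generators take the place of the indexed family in \<open>proj_span 2\<close>,
  so that a line can be rewritten in terms of any two of its points.\<close>

definition line_through :: "(nat \<Rightarrow> 'a::field) \<Rightarrow> (nat \<Rightarrow> 'a) \<Rightarrow> (nat \<Rightarrow> 'a) set set" where
  "line_through p q = {pt (scale a p + scale b q) | a b. a \<noteq> 0 \<or> b \<noteq> 0}"

lemma line_through_memI: "a \<noteq> 0 \<or> b \<noteq> 0 \<Longrightarrow> pt (scale a p + scale b q) \<in> line_through p q"
  by (auto simp: line_through_def)

lemma line_through_mem [simp]: "pt p \<in> line_through p q" "pt q \<in> line_through p q"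
  using line_through_memI[of 1 0 p q] line_through_memI[of 0 1 p q] by auto

lemma lin_comb_2: "lin_comb 2 c e = scale (c 0) (e 0) + scale (c 1) (e 1)"
  by (simp add: numeral_2_eq_2 lin_comb_Suc)

lemma ex_less_2: "(\<exists>i<2. P i) \<longleftrightarrow> P 0 \<or> P (1::nat)" "(\<forall>i<2. P i) \<longleftrightarrow> P 0 \<and> P (1::nat)"
  by (auto simp: less_2_cases_iff)

lemma choose2: "\<exists>c. c 0 = a \<and> c (1::nat) = b"
  by (rule exI[of _ "\<lambda>i. if i = 0 then a else b"]) simp

lemma proj_span_2: "proj_span 2 e = line_through (e 0) (e 1)"
  unfolding proj_span_def line_through_def lin_comb_2 ex_less_2
  by (intro Collect_cong iffI) (metis, metis choose2)

lemma lin_indep_2: "lin_indep 2 e \<longleftrightarrow> indep2 (e 0) (e 1)"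
  unfolding lin_indep_def indep2_def lin_comb_2 ex_less_2 zero_vec
  by (metis choose2)

lemma proj_lines_eq:
  "proj_lines d = {line_through p q | p q. p \<in> vecs d \<and> q \<in> vecs d \<and> indep2 p q}"
  unfolding proj_lines_def proj_span_2 lin_indep_2 ex_less_2
  by safe (metis choose2)+

text \<open>The coordinates of \<open>r\<close> and \<open>s\<close> with respect to
  \<open>p\<close> and \<open>q\<close> form a two-by-two matrix. A vanishing determinant would
  yield a linear relation between \<open>r\<close> and \<open>s\<close>, so the change of generators
  can be inverted.\<close>

lemma line_through_unique:
  fixes p q :: "nat \<Rightarrow> 'a::field"
  assumes rs: "indep2 r s" "pt r \<in> line_through p q" "pt s \<in> line_through p q"
  shows "line_through p q = line_through r s"
proof -
  have ex: "\<exists>a b. r = scale a p + scale b q" if r: "pt r \<in> line_through p q" "r \<noteq> 0" for r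
  proof -
    obtain a b where "pt r = pt (scale a p + scale b q)"
      using r(1) unfolding line_through_def by blast
    then obtain c where "r = scale c (scale a p + scale b q)"
      using r pt_eqE by metis
    then show ?thesis
      by (auto simp: scale_add)
  qed
  obtain a b where r: "r = scale a p + scale b q"
    using ex[OF rs(2)] rs(1) unfolding indep2_iff by blast
  obtain a' b' where s: "s = scale a' p + scale b' q"
    using ex[OF rs(3)] rs(1) unfolding indep2_iff by blast
  define D where "D = a * b' - a' * b"
  have D: "D \<noteq> 0"
  proof
    assume "D = 0"
    then have e: "a * b' = a' * b"
      by (simp add: D_def)
    have "scale b' r + scale (- b) s = 0" "scale a' r + scale (- a) s = 0"
      using e unfolding r s
      by (auto simp: scale_def fun_eq_iff algebra_simps)
    then have "a = 0" "b = 0"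
      using rs(1) unfolding indep2_def by (blast dest: neg_equal_0_iff_equal[THEN iffD1])+
    then have "r = 0"
      by (simp add: r)
    then show False
      using rs(1) indep2_iff by blast
  qed
  have rs_pq: "scale A r + scale B s = scale (A * a + B * a') p + scale (A * b + B * b') q" for A B
    unfolding r s by (auto simp: scale_def fun_eq_iff algebra_simps)
  show ?thesis
  proof
    show "line_through p q \<subseteq> line_through r s"
    proof
      fix z assume "z \<in> line_through p q"
      then obtain x y where z: "z = pt (scale x p + scale y q)" "x \<noteq> 0 \<or> y \<noteq> 0"
        by (auto simp: line_through_def)
      \<comment> \<open>Cramer's rule for the system \<open>A * a + B * a' = x\<close>,
        \<open>A * b + B * b' = y\<close>.\<close>
      define A where "A = (x * b' - y * a') / D"
      define B where "B = (a * y - b * x) / D"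
      have x: "A * a + B * a' = x"
      proof -
        have "A * a + B * a' = ((x * b' - y * a') * a + (a * y - b * x) * a') / D"
          by (simp add: A_def B_def add_divide_distrib)
        also have "(x * b' - y * a') * a + (a * y - b * x) * a' = x * D"
          by (simp add: D_def algebra_simps)
        finally show ?thesis using D by simp
      qed
      have y: "A * b + B * b' = y"
      proof -
        have "A * b + B * b' = ((x * b' - y * a') * b + (a * y - b * x) * b') / D"
          by (simp add: A_def B_def add_divide_distrib)
        also have "(x * b' - y * a') * b + (a * y - b * x) * b' = y * D"
          by (simp add: D_def algebra_simps)
        finally show ?thesis using D by simp
      qed
      have "A \<noteq> 0 \<or> B \<noteq> 0"
        using x y z(2) by auto
      then show "z \<in> line_through r s"
        using line_through_memI[of A B r s] by (simp add: rs_pq x y z)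
    qed
    show "line_through r s \<subseteq> line_through p q"
    proof
      fix z assume "z \<in> line_through r s"
      then obtain A B where z: "z = pt (scale A r + scale B s)" "A \<noteq> 0 \<or> B \<noteq> 0"
        by (auto simp: line_through_def)
      then have "scale A r + scale B s \<noteq> 0"
        using rs(1) unfolding indep2_def by blast
      then have "A * a + B * a' \<noteq> 0 \<or> A * b + B * b' \<noteq> 0"
        unfolding rs_pq by auto
      then show "z \<in> line_through p q"
        unfolding z rs_pq by (rule line_through_memI)
    qed
  qed
qed

section \<open>Combinations with coefficients 0 and 1\<close>

definition emb :: "bit \<Rightarrow> 'a::field" where
  "emb b = (if b = 1 then 1 else 0)"

lemma emb_simps [simp]: "emb 0 = 0" "emb 1 = 1" "emb (a * b) = emb a * emb b"
  by (cases a; cases b; simp add: emb_def)+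

lemma emb_eq_iff [simp]: "emb a = emb b \<longleftrightarrow> a = b"
  by (cases a; cases b; simp add: emb_def)

lemma emb_eq_0_iff [simp]: "emb a = 0 \<longleftrightarrow> a = 0"
  by (cases a; simp add: emb_def)

lemma emb_mem: "emb b \<in> {0, 1}"
  by (simp add: emb_def)

text \<open>The coefficients are bits rather than field elements: they are then vectors of the model
  over the field with two elements, and adding them is addition modulo 2.\<close>

definition f2_comb :: "nat \<Rightarrow> (nat \<Rightarrow> nat \<Rightarrow> 'a::field) \<Rightarrow> (nat \<Rightarrow> bit) \<Rightarrow> nat \<Rightarrow> 'a" where
  "f2_comb m e c = lin_comb m (\<lambda>i. emb (c i)) e"

lemma f2_comb_0 [simp]: "f2_comb m e 0 = 0"
  by (simp add: f2_comb_def lin_comb_def fun_eq_iff)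

lemma f2_comb_restrict: "f2_comb m e c = f2_comb m e (\<lambda>i. if i < m then c i else 0)"
  by (auto simp: f2_comb_def lin_comb_def fun_eq_iff intro!: sum.cong)

lemma range_f2_comb_unit:
  assumes "i < m"
  shows "e i \<in> range (f2_comb m e)"
proof -
  have "f2_comb m e (\<lambda>j. if j = i then 1 else 0) = e i"
  proof
    fix n
    have "f2_comb m e (\<lambda>j. if j = i then 1 else 0) n = (\<Sum>j<m. if j = i then e j n else 0)"
      unfolding f2_comb_def lin_comb_def by (rule sum.cong) (auto simp: emb_def)
    also have "\<dots> = e i n"
      using assms by simp
    finally show "f2_comb m e (\<lambda>j. if j = i then 1 else 0) n = e i n" .
  qed
  then show ?thesis
    by (metis rangeI)
qed

text \<open>Distinct nonzero \<open>0/1\<close>-vectors see at least two of the scalars \<open>\<alpha>\<close>, \<open>\<beta>\<close>, \<open>\<alpha> + \<beta>\<close>.\<close>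

lemma binary_coeffs:
  fixes \<alpha> \<beta> :: "'a::field" and c d :: "nat \<Rightarrow> bit"
  assumes char2: "(1::'a) + 1 = 0"
    and cd: "c \<noteq> 0" "d \<noteq> 0" "c \<noteq> d"
    and comb: "\<And>i. \<alpha> * emb (c i) + \<beta> * emb (d i) \<in> {0, 1}"
  shows "\<alpha> \<in> {0, 1}" "\<beta> \<in> {0, 1}"
proof -
  have two: "x + y \<in> {0, 1} \<Longrightarrow> x \<in> {0, 1} \<Longrightarrow> y \<in> {0, 1}" for x y :: 'a
    using char2 by (auto simp: add_eq_0_iff)
  obtain i where i: "c i \<noteq> d i"
    using cd by auto
  have nz: "\<exists>j. x j = 1" if "x \<noteq> 0" for x :: "nat \<Rightarrow> bit"
    using that by (auto simp: fun_eq_iff)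
  have "\<alpha> \<in> {0, 1} \<and> \<beta> \<in> {0, 1}"
  proof (cases "c i")
    assume 0: "c i = 0"
    then have "d i = 1" using i by (cases "d i") auto
    then have b: "\<beta> \<in> {0, 1}" using comb[of i] 0 by auto
    obtain j where "c j = 1" using nz[OF cd(1)] by blast
    then show ?thesis
      using comb[of j] b two[of \<beta> \<alpha>] by (cases "d j") (auto simp: add.commute)
  next
    assume 1: "c i = 1"
    then have "d i = 0" using i by (cases "d i") auto
    then have b: "\<alpha> \<in> {0, 1}" using comb[of i] 1 by auto
    obtain j where "d j = 1" using nz[OF cd(2)] by blast
    then show ?thesis
      using comb[of j] b two[of \<alpha> \<beta>] by (cases "c j") auto
  qed
  then show "\<alpha> \<in> {0, 1}" "\<beta> \<in> {0, 1}" by auto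
qed

section \<open>Quadratic forms in characteristic two\<close>

locale char2_form =
  fixes f :: "(nat \<Rightarrow> 'a::field) \<Rightarrow> 'a"
  assumes char2: "(1::'a) + 1 = 0" and qf: "is_qform 6 f"
begin

lemma two_eq_0 [simp]: "(2::'a) = 0"
  using char2 by simp

lemma add_self [simp]: "(x::'a) + x = 0"
proof -
  have "x + x = x * (1 + 1)"
    by (simp only: distrib_left mult_1_right)
  then show ?thesis
    by (simp only: char2 mult_zero_right)
qed

lemma add_left_self [simp]: "(x::'a) + (x + y) = y"
  by (simp only: add.assoc[symmetric] add_self add_0)

lemma minus_eq [simp]: "- (x::'a) = x" "x - y = x + y"
proof -
  show minus: "- x = x" for x :: 'a
    by (rule minus_unique) simp
  show "x - y = x + y"
    by (simp only: diff_conv_add_uminus minus)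
qed

lemma eq_of_add_eq_0: "(x::'a) + y = 0 \<Longrightarrow> x = y"
  by (metis minus_eq(1) add_eq_0_iff)

text \<open>Repeated summands cancel. With \<open>ac_simps\<close>, which brings equal summands
  together, this settles the later identities between sums of \<open>u\<close> and the
  \<open>y i\<close>.\<close>

lemma vec_add_self [simp]: "(v::nat \<Rightarrow> 'a) + v = 0" "v + (v + w) = w"
  by (auto simp: fun_eq_iff)

lemma emb_add [simp]: "(emb (a + b) :: 'a) = emb a + emb b"
  by (cases a; cases b) auto

lemma lin_comb_combine:
  "scale a (lin_comb m c e) + scale b (lin_comb m d e) = lin_comb m (\<lambda>i. a * c i + b * d i) e"
  for e :: "nat \<Rightarrow> nat \<Rightarrow> 'a"
  by (auto simp: lin_comb_def scale_def fun_eq_iff sum_distrib_left sum.distrib[symmetric] algebra_simps)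

lemma f2_comb_add: "f2_comb m e (c + d) = f2_comb m e c + f2_comb m e d" for e :: "nat \<Rightarrow> nat \<Rightarrow> 'a"
  using lin_comb_combine[of 1 m "\<lambda>i. emb (c i)" e 1 "\<lambda>i. emb (d i)"]
  by (simp only: f2_comb_def plus_fun_apply emb_add mult_1_left scale_simps)

lemma range_f2_comb_add:
  "v \<in> range (f2_comb m e) \<Longrightarrow> w \<in> range (f2_comb m e) \<Longrightarrow> v + w \<in> range (f2_comb m e)"
  for e :: "nat \<Rightarrow> nat \<Rightarrow> 'a"
  by (auto simp: f2_comb_add[symmetric])

text \<open>Polarising the coefficient formula of \<open>f\<close> term by term leaves only mixed
  products; bilinearity is read off from the result.\<close>

lemma bil_expand: "\<exists>a. \<forall>u v. bil f u v = (\<Sum>i<6. \<Sum>j\<in>{i..<6}. a i j * (u i * v j + v i * u j))"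
proof -
  obtain a where f: "\<And>v. f v = (\<Sum>i<6. \<Sum>j\<in>{i..<6}. a i j * v i * v j)"
    using qf unfolding is_qform_def by blast
  have "bil f u v = (\<Sum>i<6. \<Sum>j\<in>{i..<6}. a i j * (u i * v j + v i * u j))" for u v
    unfolding bil_def f sum_subtractf[symmetric]
    by (intro sum.cong refl) (simp add: algebra_simps)
  then show ?thesis by blast
qed

lemma bil_sym: "bil f u v = bil f v u"
  by (simp add: bil_def algebra_simps)

lemma bil_add_left: "bil f (u + w) v = bil f u v + bil f w v"
  and bil_scale_left: "bil f (scale c u) v = c * bil f u v"
proof -
  obtain a where a: "\<And>u v. bil f u v = (\<Sum>i<6. \<Sum>j\<in>{i..<6}. a i j * (u i * v j + v i * u j))"
    using bil_expand by blast
  show "bil f (u + w) v = bil f u v + bil f w v"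
    unfolding a sum.distrib[symmetric]
    by (intro sum.cong refl) (simp add: algebra_simps)
  show "bil f (scale c u) v = c * bil f u v"
    unfolding a sum_distrib_left
    by (intro sum.cong refl) (simp add: algebra_simps scale_def)
qed

lemma bil_add_right: "bil f v (u + w) = bil f v u + bil f v w"
  and bil_scale_right: "bil f v (scale c u) = c * bil f v u"
  by (metis bil_sym bil_add_left) (metis bil_sym bil_scale_left)

lemma f_scale: "f (scale c v) = c * c * f v"
proof -
  obtain a where f: "\<And>v. f v = (\<Sum>i<6. \<Sum>j\<in>{i..<6}. a i j * v i * v j)"
    using qf unfolding is_qform_def by blast
  show ?thesis
    unfolding f sum_distrib_left
    by (intro sum.cong refl) (simp add: algebra_simps scale_def)
qed

lemma f_add: "f (u + v) = f u + f v + bil f u v"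
  by (simp add: bil_def plus_fun_def algebra_simps)

lemma f_0 [simp]: "f 0 = 0"
  using f_scale[of 0 0] by simp

lemma bil_self [simp]: "bil f v v = 0"
  using f_add[of v v] by simp

lemma bil_0 [simp]: "bil f 0 v = 0" "bil f v 0 = 0"
  using bil_scale_left[of 0 0 v] bil_scale_right[of v 0 0] by simp_all

lemmas form_simps = f_add f_scale bil_add_left bil_add_right bil_scale_left bil_scale_right

lemma sing_pts_iff: "v \<noteq> 0 \<Longrightarrow> pt v \<in> sing_pts 6 f \<longleftrightarrow> v \<in> vecs 6 \<and> f v = 0"
proof
  assume "v \<noteq> 0" "pt v \<in> sing_pts 6 f"
  then obtain w where w: "w \<in> vecs 6" "f w = 0" "pt w = pt v"
    by (auto simp: sing_pts_def)
  then obtain c where "v = scale c w"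
    using pt_eqE \<open>v \<noteq> 0\<close> by metis
  then show "v \<in> vecs 6 \<and> f v = 0"
    using w by (simp add: f_scale)
qed (auto simp: sing_pts_def zero_vec)

text \<open>Besides \<open>v\<close> and \<open>w\<close>, the one further singular vector
  \<open>v + w\<close> suffices, by \<open>f_add\<close>.\<close>

lemma line_singular_bil:
  assumes "indep2 v w" "line_through v w \<subseteq> sing_pts 6 f"
  shows "bil f v w = 0"
proof -
  have nz: "v \<noteq> 0" "w \<noteq> 0" "scale 1 v + scale 1 w \<noteq> 0"
    using assms(1) indep2_iff apply blast
    using assms(1) indep2_iff apply blast
    using assms(1) unfolding indep2_def by (metis one_neq_zero)
  have "pt v \<in> sing_pts 6 f" "pt w \<in> sing_pts 6 f" "pt (scale 1 v + scale 1 w) \<in> sing_pts 6 f"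
    using assms(2) line_through_mem line_through_memI[of 1 1 v w] by auto
  then have "f v = 0" "f w = 0" "f (v + w) = 0"
    using nz sing_pts_iff by auto
  then show ?thesis
    by (simp add: f_add)
qed

lemma qline_bil:
  assumes "l \<in> qlines 6 f" "pt v \<in> l" "pt w \<in> l" "pt v \<noteq> pt w" "v \<noteq> 0" "w \<noteq> 0"
  shows "l = line_through v w" "bil f v w = 0"
proof -
  have i: "indep2 v w"
    using assms indep2_iff by blast
  obtain p q where "l = line_through p q"
    using assms(1) by (auto simp: qlines_def proj_lines_eq)
  then show l: "l = line_through v w"
    using line_through_unique[OF i] assms by blast
  show "bil f v w = 0"
    using line_singular_bil[OF i] l assms(1) by (auto simp: qlines_def)
qed

end

section \<open>Points and lines of the model quadrics over the field with two elements\<close>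

lemma pt_bit: "pt (v :: nat \<Rightarrow> bit) = {0, v}"
proof -
  have UNIV: "(UNIV :: bit set) = {0, 1}"
    using bit.exhaust by blast
  show ?thesis
    unfolding pt_eq_range UNIV by auto
qed

lemma pt_bit_eq_iff [simp]: "pt (v :: nat \<Rightarrow> bit) = pt w \<longleftrightarrow> v = w"
  unfolding pt_bit by (auto simp: doubleton_eq_iff)

lemma line_through_bit:
  fixes c d :: "nat \<Rightarrow> bit"
  shows "line_through c d = {pt c, pt d, pt (c + d)}"
proof -
  have "z \<in> {pt c, pt d, pt (c + d)}" if "z \<in> line_through c d" for z
  proof -
    obtain a b where "z = pt (scale a c + scale b d)" "a \<noteq> 0 \<or> b \<noteq> 0"
      using \<open>z \<in> line_through c d\<close> by (auto simp: line_through_def)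
    then show ?thesis
      by (cases a; cases b) auto
  qed
  then show ?thesis
    using line_through_memI[of 1 1 c d] by auto
qed

lemma sing_pts_bit_iff: "pt c \<in> sing_pts m g \<longleftrightarrow> c \<in> vecs m \<and> c \<noteq> 0 \<and> g c = (0::bit)"
  by (auto simp: sing_pts_def zero_vec)

text \<open>Lines are written as triples so that they match the lines found in
  \<open>subgeom_lines_quadric\<close>.\<close>

lemma qlines_bit:
  fixes g :: "(nat \<Rightarrow> bit) \<Rightarrow> bit"
  shows "qlines m g = {{pt c, pt d, pt (c + d)} | c d. c \<in> vecs m \<and> d \<in> vecs m \<and> c \<noteq> 0 \<and> d \<noteq> 0
      \<and> c \<noteq> d \<and> g c = 0 \<and> g d = 0 \<and> g (c + d) = 0}"
proof -
  have "c + d \<noteq> 0" if "c \<noteq> d" for c d :: "nat \<Rightarrow> bit"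
  proof
    assume "c + d = 0"
    then have sum: "c i + d i = 0" for i
      by (simp add: fun_eq_iff)
    have "c i = d i" for i
      using sum[of i] by (cases "c i"; cases "d i") simp_all
    then show False
      using that by auto
  qed
  then have sub: "line_through c d \<subseteq> sing_pts m g \<longleftrightarrow>
      c \<in> vecs m \<and> d \<in> vecs m \<and> c \<noteq> 0 \<and> d \<noteq> 0 \<and> g c = 0 \<and> g d = 0 \<and> g (c + d) = 0"
    if "c \<noteq> d" for c d :: "nat \<Rightarrow> bit"
    using that by (auto simp: sing_pts_bit_iff line_through_bit)
  have "qlines m g = {line_through c d | c d. c \<in> vecs m \<and> d \<in> vecs m \<and> c \<noteq> 0 \<and> d \<noteq> 0
      \<and> c \<noteq> d \<and> line_through c d \<subseteq> sing_pts m g}"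
    unfolding qlines_def proj_lines_eq indep2_iff pt_bit_eq_iff by auto
  also have "\<dots> = {line_through c d | c d. c \<in> vecs m \<and> d \<in> vecs m \<and> c \<noteq> 0 \<and> d \<noteq> 0
      \<and> c \<noteq> d \<and> g c = 0 \<and> g d = 0 \<and> g (c + d) = 0}"
    using sub by (intro Collect_cong ex_cong1) blast
  finally show ?thesis
    by (simp only: line_through_bit)
qed

text \<open>The map that is natural to construct runs from the model to the quadric, opposite to the
  direction wanted. As lines consist of points, the inverse map carries each image line back to its
  original.\<close>

lemma geom_iso_sym:
  assumes iso: "geom_iso P L P' L'" and sub: "\<And>l. l \<in> L \<Longrightarrow> l \<subseteq> P"
  shows "geom_iso P' L' P L"
proof -
  obtain \<phi> where \<phi>: "bij_betw \<phi> P P'" "(\<lambda>l. \<phi> ` l) ` L = L'"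
    using iso by (auto simp: geom_iso_def)
  have "(\<lambda>l. inv_into P \<phi> ` l) ` L' = L"
    unfolding \<phi>(2)[symmetric] image_image[of "(`) (inv_into P \<phi>)"]
    using \<phi>(1) sub by (auto simp: bij_betw_def inv_into_image_cancel)
  then show ?thesis
    using bij_betw_inv_into[OF \<phi>(1)] unfolding geom_iso_def by blast
qed

section \<open>Subgeometries given by independent vectors\<close>

locale f2_basis = char2_form f for f :: "(nat \<Rightarrow> 'a::field) \<Rightarrow> 'a" +
  fixes m :: nat and e :: "nat \<Rightarrow> nat \<Rightarrow> 'a"
  assumes e_vecs: "\<And>i. i < m \<Longrightarrow> e i \<in> vecs 6" and indep: "lin_indep m e"
begin

abbreviation Psi :: "(nat \<Rightarrow> bit) \<Rightarrow> nat \<Rightarrow> 'a" where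
  "Psi \<equiv> f2_comb m e"

lemma Psi_vecs [simp]: "Psi c \<in> vecs 6"
  unfolding f2_comb_def by (intro vecs_lin_comb e_vecs)

lemma lin_comb_inj:
  assumes "lin_comb m c e = lin_comb m d e" "i < m"
  shows "c i = d i"
proof -
  \<comment> \<open>In characteristic two the sum of the two coefficient families is their
    difference.\<close>
  have "lin_comb m (\<lambda>i. 1 * c i + 1 * d i) e = 0"
    unfolding lin_comb_combine[symmetric] using assms by simp
  then show ?thesis
    using indep assms(2) eq_of_add_eq_0 unfolding lin_indep_def zero_vec by force
qed

lemma Psi_eq_iff:
  assumes "c \<in> vecs m" "d \<in> vecs m"
  shows "Psi c = Psi d \<longleftrightarrow> c = d"
proof
  assume eq: "Psi c = Psi d"
  show "c = d"
  proof (rule vecs_eqI[OF assms])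
    fix i assume "i < m"
    then have "(emb (c i) :: 'a) = emb (d i)"
      using lin_comb_inj[OF eq[unfolded f2_comb_def]] by blast
    then show "c i = d i"
      by simp
  qed
qed simp

lemma Psi_eq_0_iff: "c \<in> vecs m \<Longrightarrow> Psi c = 0 \<longleftrightarrow> c = 0"
  using Psi_eq_iff[of c 0] by simp

text \<open>Comparing coordinates reduces this to \<open>binary_coeffs\<close>. It is the reason why
  a line over the large field through two points of the subgeometry contains only one more of its
  points.\<close>

lemma Psi_scalars:
  assumes "c \<in> vecs m" "d \<in> vecs m" "x \<in> vecs m" "c \<noteq> 0" "d \<noteq> 0" "c \<noteq> d"
    and eq: "scale \<alpha> (Psi c) + scale \<beta> (Psi d) = Psi x"
  shows "\<alpha> \<in> {0, 1}" "\<beta> \<in> {0, 1}"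
proof -
  have "\<alpha> * emb (c i) + \<beta> * emb (d i) = emb (x i)" for i
  proof (cases "i < m")
    case True
    then show ?thesis
      using lin_comb_inj[OF eq[unfolded f2_comb_def lin_comb_combine]] by blast
  next
    case False
    then show ?thesis
      using assms by (simp add: vecs_def)
  qed
  then have "\<alpha> * emb (c i) + \<beta> * emb (d i) \<in> {0, 1}" for i
    by (simp add: emb_def)
  then show "\<alpha> \<in> {0, 1}" "\<beta> \<in> {0, 1}"
    using binary_coeffs[OF char2] assms by blast+
qed

text \<open>At a coordinate where \<open>d\<close> is 1, the product of \<open>t\<close> with 0 or 1
  equals 1, which fixes the scalar. Hence a point of the subgeometry determines its coefficient
  vector.\<close>

lemma Psi_scale_eq:
  assumes "c \<in> vecs m" "d \<in> vecs m" "d \<noteq> 0" and eq: "Psi d = scale t (Psi c)"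
  shows "t = 1" "c = d"
proof -
  \<comment> \<open>The summand \<open>0 * 0\<close> gives the second family the two-term shape
    produced by \<open>lin_comb_combine\<close>.\<close>
  have co: "emb (d i) = t * emb (c i)" if "i < m" for i
    using lin_comb_inj[of "\<lambda>i. emb (d i)" "\<lambda>i. t * emb (c i) + 0 * 0"] that
      eq[unfolded f2_comb_def] lin_comb_combine[of t m "\<lambda>i. emb (c i)" e 0 "\<lambda>_. 0"] by simp
  obtain i where "d i = 1" "i < m"
  proof -
    obtain i where "d i \<noteq> 0" using assms by (auto simp: fun_eq_iff)
    then show ?thesis
      using that assms(2) by (cases "i < m") (auto simp: vecs_def)
  qed
  then have "t * emb (c i) = 1"
    using co[of i] by simp
  then show "t = 1"
    by (cases "c i") auto
  then show "c = d"
    using assms Psi_eq_iff by simp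
qed

lemma pt_Psi_eq_iff:
  assumes "c \<in> vecs m" "d \<in> vecs m" "c \<noteq> 0" "d \<noteq> 0"
  shows "pt (Psi c) = pt (Psi d) \<longleftrightarrow> c = d"
proof
  assume "pt (Psi c) = pt (Psi d)"
  then obtain t where "Psi d = scale t (Psi c)"
    using pt_eqE assms Psi_eq_0_iff by metis
  then show "c = d"
    using Psi_scale_eq assms by blast
qed auto

definition subgeometry :: "(nat \<Rightarrow> 'a) set set" where
  "subgeometry = {pt (Psi c) | c. c \<in> vecs m \<and> c \<noteq> 0}"

text \<open>Translates between bit coefficients and the field elements 0 and 1 used in
  \<open>F2_subgeometry\<close>; bits from index \<open>m\<close> on are set to zero.\<close>

lemma subgeometry_alt:
  "subgeometry = {pt (lin_comb m c e) | c. (\<forall>i<m. c i \<in> {0, 1}) \<and> (\<exists>i<m. c i \<noteq> 0)}" (is "_ = ?R")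
proof
  show "subgeometry \<subseteq> ?R"
  proof
    fix P assume "P \<in> subgeometry"
    then obtain c where c: "P = pt (Psi c)" "c \<in> vecs m" "c \<noteq> 0"
      by (auto simp: subgeometry_def)
    then have "\<exists>i<m. c i \<noteq> 0"
      using vecs_eqI[of c m 0] by (metis vecs_closed(1) zero_fun_apply)
    then show "P \<in> ?R"
      using c(1) unfolding f2_comb_def
      by (intro CollectI exI[of _ "\<lambda>i. emb (c i)"] conjI allI impI emb_mem) simp_all
  qed
  show "?R \<subseteq> subgeometry"
  proof
    fix P assume "P \<in> ?R"
    then obtain c where c: "P = pt (lin_comb m c e)" "\<And>i. i < m \<Longrightarrow> c i \<in> {0, 1}" "\<exists>i<m. c i \<noteq> 0"
      by auto
    define b :: "nat \<Rightarrow> bit" where "b = (\<lambda>i. if i < m \<and> c i \<noteq> 0 then 1 else 0)"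
    have "c i = emb (b i)" if "i < m" for i
      using c(2)[OF that] that by (auto simp: b_def)
    then have "lin_comb m c e = Psi b"
      by (simp add: f2_comb_def lin_comb_def)
    moreover have "b \<in> vecs m" "b \<noteq> 0"
      using c(3) by (auto simp: b_def vecs_def fun_eq_iff)
    ultimately show "P \<in> subgeometry"
      using c(1) by (auto simp: subgeometry_def)
  qed
qed

text \<open>Each of \<open>v\<close>, \<open>w\<close>, \<open>v + w\<close> is a scalar times a
  value of \<open>Psi\<close>. After division by the scalar of \<open>v + w\<close>, the other two
  scalars lie in {0, 1} by \<open>Psi_scalars\<close>; being nonzero, they are 1, so all three
  scalars agree.\<close>

lemma same_scale:
  assumes G: "pt v \<in> subgeometry" "pt w \<in> subgeometry" "pt (v + w) \<in> subgeometry"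
    and nz: "v \<noteq> 0" "w \<noteq> 0" "v + w \<noteq> 0" and ne: "pt v \<noteq> pt w"
  obtains t c d where "t \<noteq> 0" "c \<in> vecs m" "d \<in> vecs m" "c + d \<noteq> 0" "v = scale t (Psi c)" "w = scale t (Psi d)"
proof -
  have ex: "\<exists>t c. v = scale t (Psi c) \<and> t \<noteq> 0 \<and> c \<in> vecs m \<and> c \<noteq> 0"
    if v: "pt v \<in> subgeometry" "v \<noteq> 0" for v
  proof -
    obtain c where "pt (Psi c) = pt v" "c \<in> vecs m" "c \<noteq> 0"
      using v(1) unfolding subgeometry_def by force
    then show ?thesis
      using pt_eqE[of "Psi c" v] v(2) by metis
  qed
  obtain \<alpha> c where c: "v = scale \<alpha> (Psi c)" "\<alpha> \<noteq> 0" "c \<in> vecs m" "c \<noteq> 0"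
    using ex G nz by blast
  obtain \<beta> d where d: "w = scale \<beta> (Psi d)" "\<beta> \<noteq> 0" "d \<in> vecs m" "d \<noteq> 0"
    using ex G nz by blast
  obtain \<epsilon> x where x: "v + w = scale \<epsilon> (Psi x)" "\<epsilon> \<noteq> 0" "x \<in> vecs m" "x \<noteq> 0"
    using ex G nz by blast
  have cd: "c \<noteq> d"
    using ne c d by auto
  have "scale (\<alpha> / \<epsilon>) (Psi c) + scale (\<beta> / \<epsilon>) (Psi d) = scale (1 / \<epsilon>) (v + w)"
    by (simp add: c(1) d(1) scale_add)
  also have "\<dots> = Psi x"
    using x by simp
  finally have "\<alpha> / \<epsilon> \<in> {0, 1}" "\<beta> / \<epsilon> \<in> {0, 1}"
    using Psi_scalars[of c d x] c d x cd by blast+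
  then have "\<alpha> = \<epsilon>" "\<beta> = \<epsilon>"
    using c d x by auto
  moreover have "c + d \<noteq> 0"
  proof
    assume "c + d = 0"
    then have "Psi c + Psi d = 0"
      using f2_comb_add[of m e c d] by simp
    then have "v + w = 0"
      using calculation c d by (simp add: scale_add[symmetric])
    then show False
      using nz by simp
  qed
  ultimately show thesis
    using that[of \<epsilon> c d] c d x by blast
qed

end

context char2_form
begin

text \<open>\<open>u\<close> lies on the lines joining \<open>y\<close> with \<open>y + u\<close> and \<open>y'\<close> with \<open>y' + u\<close>. The common point
  \<open>y + y' + u\<close> of the cross-joins forces the four points to carry the same scalar.\<close>

lemma F2_subgeometry_mem:
  fixes G :: "(nat \<Rightarrow> 'a) set set"
  assumes G: "F2_subgeometry 6 G"
    and mem: "{pt y, pt y', pt (y + u), pt (y' + u), pt (y + y' + u)} \<subseteq> G"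
    and ne: "pt y \<noteq> pt (y' + u)" "pt y' \<noteq> pt (y + u)"
    and nz: "y \<noteq> 0" "y' \<noteq> 0" "u \<noteq> 0" "y + u \<noteq> 0" "y' + u \<noteq> 0" "y + y' + u \<noteq> 0"
  shows "pt u \<in> G"
proof -
  obtain m and e :: "nat \<Rightarrow> nat \<Rightarrow> 'a" where e: "\<And>i. i < m \<Longrightarrow> e i \<in> vecs 6" "lin_indep m e"
    and G': "G = {pt (lin_comb m c e) | c. (\<forall>i<m. c i \<in> {0, 1}) \<and> (\<exists>i<m. c i \<noteq> 0)}"
    using G unfolding F2_subgeometry_def by blast
  interpret f2_basis f m e
    by unfold_locales (use e in auto)
  have GS: "G = subgeometry"
    unfolding G' subgeometry_alt ..
  obtain t c d where 1: "t \<noteq> 0" "c \<in> vecs m" "d \<in> vecs m" "c + d \<noteq> 0"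
      "y = scale t (Psi c)" "y' + u = scale t (Psi d)"
    using same_scale[of y "y' + u"] mem nz ne unfolding GS by (auto simp: add.assoc)
  have z: "y' + (y + u) = y + y' + u"
    by (simp add: ac_simps)
  obtain s c' d' where 2: "s \<noteq> 0" "c' \<in> vecs m" "d' \<in> vecs m" "c' + d' \<noteq> 0"
      "y' = scale s (Psi c')" "y + u = scale s (Psi d')"
    using same_scale[of y' "y + u"] mem nz ne unfolding GS z by auto
  have "scale t (Psi (c + d)) = y + y' + u" "scale s (Psi (c' + d')) = y + y' + u"
    using 1 2 z by (simp_all add: f2_comb_add scale_add add.assoc)
  then have "scale (1 / s) (scale s (Psi (c' + d'))) = scale (1 / s) (scale t (Psi (c + d)))"
    by simp
  then have eq: "Psi (c' + d') = scale (t / s) (Psi (c + d))"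
    using 2 by simp
  have "t / s = 1"
    using Psi_scale_eq(1)[OF _ _ _ eq] 1(2,3) 2(2-4) by simp
  then have ts: "t = s"
    using 2 by simp
  have "u = y + (y + u)"
    by simp
  also have "\<dots> = scale t (Psi (c + d'))"
    using 1 2 ts by (simp only: f2_comb_add scale_add)
  finally have u: "u = scale t (Psi (c + d'))" .
  then have "c + d' \<noteq> 0"
    using nz by auto
  then show ?thesis
    unfolding GS subgeometry_def u using 1 2 by auto
qed

end

section \<open>Quadrics inside a subgeometry\<close>

locale f2_frame = f2_basis f m e for f :: "(nat \<Rightarrow> 'a::field) \<Rightarrow> 'a" and m e +
  fixes g :: "(nat \<Rightarrow> bit) \<Rightarrow> bit"
  assumes m_le: "m \<le> 6" and form: "\<And>c. f (Psi c) = emb (g c)"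
begin

definition quadric :: "(nat \<Rightarrow> 'a) set set" where
  "quadric = {pt (Psi c) | c. c \<in> vecs m \<and> c \<noteq> 0 \<and> g c = 0}"

lemma quadric_iff: "c \<in> vecs m \<Longrightarrow> c \<noteq> 0 \<Longrightarrow> pt (Psi c) \<in> quadric \<longleftrightarrow> g c = 0"
  using pt_Psi_eq_iff by (auto simp: quadric_def)

lemma quadric_subset: "quadric \<subseteq> sing_pts 6 f"
  by (auto simp: quadric_def sing_pts_iff Psi_eq_0_iff form)

lemma F2_subgeometry_subgeometry: "F2_subgeometry 6 subgeometry"
  unfolding F2_subgeometry_def subgeometry_alt using m_le indep e_vecs by blast

lemma quadric_F2: "is_F2_subgeometry_set 6 quadric"
  unfolding is_F2_subgeometry_set_def
  by (intro exI[of _ subgeometry] conjI F2_subgeometry_subgeometry)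
    (auto simp: quadric_def subgeometry_def)

text \<open>The line is totally singular over the whole field since \<open>f\<close> vanishes on
  both generators and \<open>bil f\<close> on the pair. By \<open>Psi_scalars\<close>, a point of
  the quadric on it can only have coefficients (1,0), (0,1) or (1,1).\<close>

lemma line_meet:
  assumes c: "c \<in> vecs m" "c \<noteq> 0" "g c = 0" and d: "d \<in> vecs m" "d \<noteq> 0" "g d = 0"
    and cd: "c \<noteq> d" and perp: "bil f (Psi c) (Psi d) = 0"
  shows "line_through (Psi c) (Psi d) \<in> qlines 6 f" (is "?l \<in> _")
    and "line_through (Psi c) (Psi d) \<inter> quadric = {pt (Psi c), pt (Psi d), pt (Psi (c + d))}"
    and "g (c + d) = 0"
proof -
  have i: "indep2 (Psi c) (Psi d)"
    unfolding indep2_iff using c d cd pt_Psi_eq_iff Psi_eq_0_iff by auto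
  have f0: "f (Psi c) = 0" "f (Psi d) = 0"
    by (simp_all add: form c d)
  have "f (Psi (c + d)) = 0"
    by (simp add: f2_comb_add f_add f0 perp)
  then show g: "g (c + d) = 0"
    by (simp add: form)
  have "?l \<subseteq> sing_pts 6 f"
  proof
    fix z assume "z \<in> ?l"
    then obtain a b where z: "z = pt (scale a (Psi c) + scale b (Psi d))" "a \<noteq> 0 \<or> b \<noteq> 0"
      by (auto simp: line_through_def)
    then have "scale a (Psi c) + scale b (Psi d) \<noteq> 0"
      using i unfolding indep2_def by blast
    then show "z \<in> sing_pts 6 f"
      unfolding z(1) by (simp add: sing_pts_iff form_simps f0 perp)
  qed
  then show "?l \<in> qlines 6 f"
    unfolding qlines_def proj_lines_eq using i Psi_vecs by blast
  show "?l \<inter> quadric = {pt (Psi c), pt (Psi d), pt (Psi (c + d))}"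
  proof
    show "?l \<inter> quadric \<subseteq> {pt (Psi c), pt (Psi d), pt (Psi (c + d))}"
    proof
      fix z assume "z \<in> ?l \<inter> quadric"
      then obtain a b x where z: "z = pt (scale a (Psi c) + scale b (Psi d))"
        and x: "z = pt (Psi x)" "x \<in> vecs m" "x \<noteq> 0"
        by (auto simp: line_through_def quadric_def)
      then obtain t where t: "t \<noteq> 0" "Psi x = scale t (scale a (Psi c) + scale b (Psi d))"
        using pt_eqE Psi_eq_0_iff by metis
      then have eq: "scale (t * a) (Psi c) + scale (t * b) (Psi d) = Psi x"
        by (simp add: scale_add)
      then have ab: "t * a \<in> {0, 1}" "t * b \<in> {0, 1}"
        using Psi_scalars c d x cd by blast+
      have "Psi x \<noteq> 0"
        using x Psi_eq_0_iff by blast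
      then have "Psi x = Psi c \<or> Psi x = Psi d \<or> Psi x = Psi (c + d)"
        using ab eq unfolding f2_comb_add by (elim insertE emptyE) auto
      then show "z \<in> {pt (Psi c), pt (Psi d), pt (Psi (c + d))}"
        using x by auto
    qed
    have "c + d \<noteq> 0"
    proof
      assume "c + d = 0"
      then have "Psi c + Psi d = 0"
        by (metis f2_comb_add f2_comb_0)
      then show False
        using i[unfolded indep2_def, rule_format, of 1 1] by simp
    qed
    moreover have "pt (Psi (c + d)) \<in> ?l"
      using line_through_memI[of 1 1 "Psi c" "Psi d"] by (simp add: f2_comb_add)
    ultimately show "{pt (Psi c), pt (Psi d), pt (Psi (c + d))} \<subseteq> ?l \<inter> quadric"
      using c d g by (simp add: quadric_iff)
  qed
qed

text \<open>For singular \<open>c\<close> and \<open>d\<close>, orthogonality of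
  \<open>Psi c\<close> and \<open>Psi d\<close> amounts to \<open>g (c + d) = 0\<close>, so the
  traces of the lines of the large quadric are the lines of \<open>g\<close>.\<close>

lemma subgeom_lines_quadric:
  "subgeom_lines 6 f quadric = {{pt (Psi c), pt (Psi d), pt (Psi (c + d))} | c d.
      c \<in> vecs m \<and> d \<in> vecs m \<and> c \<noteq> 0 \<and> d \<noteq> 0 \<and> c \<noteq> d \<and> g c = 0 \<and> g d = 0 \<and> g (c + d) = 0}" (is "_ = ?R")
proof
  show "subgeom_lines 6 f quadric \<subseteq> ?R"
  proof
    fix k assume "k \<in> subgeom_lines 6 f quadric"
    then obtain l where l: "k = l \<inter> quadric" "l \<in> qlines 6 f" "2 \<le> card (l \<inter> quadric)"
      by (auto simp: subgeom_lines_def)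
    obtain P Q where PQ: "P \<in> l \<inter> quadric" "Q \<in> l \<inter> quadric" "P \<noteq> Q"
    proof -
      obtain T where "T \<subseteq> l \<inter> quadric" "card T = 2"
        using obtain_subset_with_card_n[OF l(3)] by metis
      then show thesis
        using that by (auto simp: card_2_iff)
    qed
    obtain c where c: "P = pt (Psi c)" "c \<in> vecs m" "c \<noteq> 0" "g c = 0"
      using PQ by (auto simp: quadric_def)
    obtain d where d: "Q = pt (Psi d)" "d \<in> vecs m" "d \<noteq> 0" "g d = 0"
      using PQ by (auto simp: quadric_def)
    have cd: "c \<noteq> d"
      using PQ c d by auto
    have "l = line_through (Psi c) (Psi d)" "bil f (Psi c) (Psi d) = 0"
      using qline_bil[OF l(2)] PQ c d Psi_eq_0_iff by auto
    then show "k \<in> ?R"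
      using line_meet(2,3)[of c d] c d cd l(1) by blast
  qed
  show "?R \<subseteq> subgeom_lines 6 f quadric"
  proof
    fix k assume "k \<in> ?R"
    then obtain c d where k: "k = {pt (Psi c), pt (Psi d), pt (Psi (c + d))}"
      and c: "c \<in> vecs m" "c \<noteq> 0" "g c = 0" and d: "d \<in> vecs m" "d \<noteq> 0" "g d = 0"
      and cd: "c \<noteq> d" and g: "g (c + d) = 0"
      by auto
    have "f (Psi (c + d)) = 0"
      by (simp add: form g)
    then have perp: "bil f (Psi c) (Psi d) = 0"
      unfolding f2_comb_add f_add by (simp add: form c d)
    have "card {pt (Psi c), pt (Psi d)} \<le> card k"
      unfolding k by (rule card_mono) auto
    then have "2 \<le> card k"
      using pt_Psi_eq_iff c d cd by simp
    then show "k \<in> subgeom_lines 6 f quadric"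
      unfolding subgeom_lines_def k line_meet(2)[OF c d cd perp, symmetric]
      using line_meet(1)[OF c d cd perp] by (intro CollectI exI conjI refl) simp_all
  qed
qed

lemma quadric_iso: "geom_iso quadric (subgeom_lines 6 f quadric) (sing_pts m g) (qlines m g)"
proof (rule geom_iso_sym)
  \<comment> \<open>A model point is \<open>{0, c}\<close>, so taking the union avoids choosing a
    representative; the part \<open>pt 0\<close> is absorbed by \<open>pt (Psi c)\<close>.\<close>
  define h where "h P = (\<Union>c\<in>P. pt (Psi c))" for P
  have h: "h (pt c) = pt (Psi c)" for c
  proof -
    have "h (pt c) = pt 0 \<union> pt (Psi c)"
      by (simp add: h_def pt_bit)
    moreover have "pt (0 :: nat \<Rightarrow> 'a) \<subseteq> pt (Psi c)"
      unfolding pt_eq_range using rangeI[of "\<lambda>a. scale a (Psi c)" 0] by auto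
    ultimately show ?thesis by blast
  qed
  let ?V = "{c \<in> vecs m. c \<noteq> 0 \<and> g c = 0}"
  have sing: "sing_pts m g = pt ` ?V"
    by (auto simp: sing_pts_def zero_vec)
  have inj: "inj_on (\<lambda>c. pt (Psi c)) ?V"
    using pt_Psi_eq_iff unfolding inj_on_def by blast
  have "inj_on h (pt ` ?V)"
  proof (rule inj_onI)
    fix P Q assume "P \<in> pt ` ?V" "Q \<in> pt ` ?V" and eq: "h P = h Q"
    then obtain c d where cd: "P = pt c" "Q = pt d" "c \<in> ?V" "d \<in> ?V"
      by blast
    have "pt (Psi c) = pt (Psi d)"
      using eq unfolding cd h .
    then show "P = Q"
      using inj_onD[OF inj] cd by blast
  qed
  moreover have "h ` pt ` ?V = quadric"
    unfolding image_image h quadric_def by blast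
  ultimately have "bij_betw h (sing_pts m g) quadric"
    by (simp add: bij_betw_def sing)
  moreover have "(\<lambda>l. h ` l) ` qlines m g = subgeom_lines 6 f quadric"
  proof -
    have hl: "h ` {pt c, pt d, pt (c + d)} = {pt (Psi c), pt (Psi d), pt (Psi (c + d))}" for c d
      by (simp add: h)
    show ?thesis
      unfolding qlines_bit subgeom_lines_quadric
    proof (intro set_eqI iffI; elim imageE CollectE exE conjE)
      fix k l c d
      assume "k = h ` l" "l = {pt c, pt d, pt (c + d)}" 
        and c: "c \<in> vecs m" "d \<in> vecs m" "c \<noteq> 0" "d \<noteq> 0" "c \<noteq> d" "g c = 0" "g d = 0" "g (c + d) = 0"
      then have "k = {pt (Psi c), pt (Psi d), pt (Psi (c + d))}"
        by (simp only: hl)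
      with c show "k \<in> {{pt (Psi c), pt (Psi d), pt (Psi (c + d))} | c d.
          c \<in> vecs m \<and> d \<in> vecs m \<and> c \<noteq> 0 \<and> d \<noteq> 0 \<and> c \<noteq> d \<and> g c = 0 \<and> g d = 0 \<and> g (c + d) = 0}"
        by blast
    next
      fix k c d
      assume "k = {pt (Psi c), pt (Psi d), pt (Psi (c + d))}"
        and c: "c \<in> vecs m" "d \<in> vecs m" "c \<noteq> 0" "d \<noteq> 0" "c \<noteq> d" "g c = 0" "g d = 0" "g (c + d) = 0"
      then have "k = h ` {pt c, pt d, pt (c + d)}"
        by (simp only: hl)
      with c show "k \<in> (`) h ` {{pt c, pt d, pt (c + d)} | c d.
          c \<in> vecs m \<and> d \<in> vecs m \<and> c \<noteq> 0 \<and> d \<noteq> 0 \<and> c \<noteq> d \<and> g c = 0 \<and> g d = 0 \<and> g (c + d) = 0}"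
        by blast
    qed
  qed
  ultimately show "geom_iso (sing_pts m g) (qlines m g) quadric (subgeom_lines 6 f quadric)"
    unfolding geom_iso_def by blast
qed (auto simp: qlines_def)

lemma quadric_memI:
  assumes "v \<in> range Psi" "f v = 0" "v \<noteq> 0"
  shows "pt v \<in> quadric"
proof -
  obtain c where c: "v = Psi c"
    using assms by blast
  define d where "d = (\<lambda>i. if i < m then c i else 0)"
  have d: "v = Psi d" "d \<in> vecs m"
    using c f2_comb_restrict[of m e c] by (auto simp: d_def vecs_def)
  then have "d \<noteq> 0"
    using assms by auto
  then show ?thesis
    using d assms quadric_iff form by (metis emb_eq_0_iff)
qed

end

lemma lin_comb_numeral:
  "lin_comb 4 c e = scale (c 0) (e 0) + scale (c 1) (e 1) + scale (c 2) (e 2) + scale (c 3) (e 3)"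
  "lin_comb 5 c e = lin_comb 4 c e + scale (c 4) (e 4)"
  "lin_comb 6 c e = lin_comb 5 c e + scale (c 5) (e 5)"
  by (simp_all add: eval_nat_numeral lin_comb_Suc)

lemma less_numeral:
  "(i::nat) < 3 \<longleftrightarrow> i = 0 \<or> i = 1 \<or> i = 2"
  "i < 4 \<longleftrightarrow> i < 3 \<or> i = 3"
  "i < 5 \<longleftrightarrow> i < 4 \<or> i = 4"
  "i < 6 \<longleftrightarrow> i < 5 \<or> i = 5"
  by auto

text \<open>Serves to pass from injectivity to surjectivity of a linear map on the six-dimensional
  space.\<close>

lemma finite_vecs: "finite (vecs d :: (nat \<Rightarrow> 'a::{field, finite}) set)"
proof -
  have "finite {v :: nat \<Rightarrow> 'a. \<forall>i. (i \<in> {..<d} \<longrightarrow> v i \<in> UNIV) \<and> (i \<notin> {..<d} \<longrightarrow> v i = 0)}"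
    by (rule finite_set_of_finite_funs) auto
  then show ?thesis
    by (simp add: vecs_def not_less)
qed

section \<open>Gram matrices of the normalised vectors\<close>

locale centric_vectors = char2_form f for f :: "(nat \<Rightarrow> 'a::{field, finite}) \<Rightarrow> 'a" +
  fixes H0 :: "(nat \<Rightarrow> 'a) set set" and u :: "nat \<Rightarrow> 'a" and k :: nat and y :: "nat \<Rightarrow> nat \<Rightarrow> 'a"
  assumes k3: "3 \<le> k" and u_vecs: "u \<in> vecs 6" and f_u: "f u = 1"
    and H0_iff: "\<And>v. v \<in> vecs 6 \<Longrightarrow> v \<noteq> 0 \<Longrightarrow> pt v \<in> H0 \<longleftrightarrow> bil f u v = 0"
    and y_vecs: "\<And>i. i < k \<Longrightarrow> y i \<in> vecs 6" and f_y: "\<And>i. i < k \<Longrightarrow> f (y i) = 0"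
    and bil_uy: "\<And>i. i < k \<Longrightarrow> bil f u (y i) = 1"
    and bil_yy: "\<And>i j. i < k \<Longrightarrow> j < k \<Longrightarrow> i \<noteq> j \<Longrightarrow> bil f (y i) (y j) = 1"
begin

declare One_nat_def [simp del]

lemma bil_yu: "i < k \<Longrightarrow> bil f (y i) u = 1"
  using bil_uy bil_sym by metis

lemma numeral_char2: "(numeral (Num.Bit0 n) :: 'a) = 0" "(numeral (Num.Bit1 n) :: 'a) = 1"
  by (simp_all only: numeral.simps add_self add_0)

text \<open>Chosen so that on the \<open>0/1\<close>-combinations of \<open>e 0\<close>, ..., \<open>e (m - 1)\<close> with \<open>m = 4, 5, 6\<close>
  the form is literally the standard one: \<open>e 0, e 1\<close> and \<open>e 2, e 3\<close> are orthogonal hyperbolic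
  pairs, and \<open>e 4, e 5\<close> are nonsingular vectors in their perp.\<close>

definition e :: "nat \<Rightarrow> nat \<Rightarrow> 'a" where
  "e i = (if i = 0 then y 0 else if i = 1 then y 1 else if i = 2 then u + y 0 + y 1
     else if i = 3 then u + y 2 else y (i - 1) + (u + y 0 + y 1 + y 2))"

lemma e_simps: "e 0 = y 0" "e 1 = y 1" "e 2 = u + y 0 + y 1" "e 3 = u + y 2"
    "e 4 = y 3 + (u + y 0 + y 1 + y 2)" "e 5 = y 4 + (u + y 0 + y 1 + y 2)"
  by (simp_all add: e_def)

lemmas gram_simps = e_simps form_simps f_u f_y bil_uy bil_yu bil_yy numeral_char2

lemma e_vecs: "i \<le> k \<Longrightarrow> e i \<in> vecs 6"
  using k3 by (auto simp: e_def y_vecs u_vecs)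

text \<open>Only \<open>u\<close> and the first three vectors \<open>y i\<close> enter here;
  \<open>gram5\<close> and \<open>gram6\<close> bring in \<open>y 3\<close> and \<open>y 4\<close>.
  The pairings with \<open>u\<close> decide, through \<open>H0_iff\<close>, which points lie off
  \<open>H0\<close>.\<close>

lemma gram4:
  "f (e 0) = 0" "f (e 1) = 0" "f (e 2) = 0" "f (e 3) = 0"
  "bil f (e 0) (e 1) = 1" "bil f (e 0) (e 2) = 0" "bil f (e 0) (e 3) = 0"
  "bil f (e 1) (e 2) = 0" "bil f (e 1) (e 3) = 0" "bil f (e 2) (e 3) = 1"
  "bil f u (e 0) = 1" "bil f u (e 1) = 1" "bil f u (e 2) = 0" "bil f u (e 3) = 1"
  using k3 by (simp_all add: gram_simps)

lemma gram5:
  assumes "4 \<le> k"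
  shows "f (e 4) = 1" "bil f (e 0) (e 4) = 0" "bil f (e 1) (e 4) = 0" "bil f (e 2) (e 4) = 0"
    "bil f (e 3) (e 4) = 0" "bil f u (e 4) = 0"
  using assms by (simp_all add: gram_simps)

lemma gram6:
  assumes "5 \<le> k"
  shows "f (e 5) = 1" "bil f (e 0) (e 5) = 0" "bil f (e 1) (e 5) = 0" "bil f (e 2) (e 5) = 0"
    "bil f (e 3) (e 5) = 0" "bil f (e 4) (e 5) = 1" "bil f u (e 5) = 0"
  using assms by (simp_all add: gram_simps)

lemma gram_sym:
  "bil f (e 1) (e 0) = bil f (e 0) (e 1)" "bil f (e 2) (e 0) = bil f (e 0) (e 2)"
  "bil f (e 3) (e 0) = bil f (e 0) (e 3)" "bil f (e 2) (e 1) = bil f (e 1) (e 2)"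
  "bil f (e 3) (e 1) = bil f (e 1) (e 3)" "bil f (e 3) (e 2) = bil f (e 2) (e 3)"
  "bil f (e 4) (e 0) = bil f (e 0) (e 4)" "bil f (e 4) (e 1) = bil f (e 1) (e 4)"
  "bil f (e 4) (e 2) = bil f (e 2) (e 4)" "bil f (e 4) (e 3) = bil f (e 3) (e 4)"
  "bil f (e 5) (e 0) = bil f (e 0) (e 5)" "bil f (e 5) (e 1) = bil f (e 1) (e 5)"
  "bil f (e 5) (e 2) = bil f (e 2) (e 5)" "bil f (e 5) (e 3) = bil f (e 3) (e 5)"
  "bil f (e 5) (e 4) = bil f (e 4) (e 5)"
  by (rule bil_sym)+

text \<open>The Gram matrix is nonsingular: pairing a vanishing combination with the partner in a
  hyperbolic pair isolates one coefficient.\<close>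

lemma basis4: "f2_basis f 4 e"
proof
  show "e i \<in> vecs 6" if "i < 4" for i
    using e_vecs k3 that by auto
  show "lin_indep 4 e"
    unfolding lin_indep_def zero_vec
  proof (intro allI impI)
    fix c :: "nat \<Rightarrow> 'a" and i :: nat
    assume z: "lin_comb 4 c e = 0" and i: "i < 4"
    have "bil f (e j) (lin_comb 4 c e) = 0" for j
      unfolding z by simp
    from this[of 0] this[of 1] this[of 2] this[of 3] show "c i = 0"
      using i by (auto simp: less_numeral lin_comb_numeral form_simps gram4 gram_sym)
  qed
qed

text \<open>In odd dimension the alternating form is degenerate: \<open>e 4\<close> is orthogonal to
  all five vectors. Its coefficient is reached through \<open>f\<close> instead, whose value is
  \<open>c 4 * c 4\<close> once the other coefficients vanish.\<close>

lemma basis5: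
  assumes k: "4 \<le> k"
  shows "f2_basis f 5 e"
proof
  show "e i \<in> vecs 6" if "i < 5" for i
    using e_vecs k that by auto
  show "lin_indep 5 e"
    unfolding lin_indep_def zero_vec
  proof (intro allI impI)
    fix c :: "nat \<Rightarrow> 'a" and i :: nat
    assume z: "lin_comb 5 c e = 0" and i: "i < 5"
    have "bil f (e j) (lin_comb 5 c e) = 0" for j
      unfolding z by simp
    from this[of 0] this[of 1] this[of 2] this[of 3]
    have c: "c 0 = 0" "c 1 = 0" "c 2 = 0" "c 3 = 0"
      by (simp_all add: lin_comb_numeral form_simps gram4 gram5[OF k] gram_sym)
    have "f (lin_comb 5 c e) = 0"
      unfolding z by simp
    then have "c 4 = 0"
      by (simp add: lin_comb_numeral form_simps gram5[OF k] c)
    then show "c i = 0"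
      using i c by (auto simp: less_numeral)
  qed
qed

text \<open>Since \<open>e 4\<close> and \<open>e 5\<close> pair to 1, the Gram matrix is
  nonsingular again.\<close>

lemma basis6:
  assumes k: "5 \<le> k"
  shows "f2_basis f 6 e"
proof
  have k4: "4 \<le> k" using k by simp
  show "e i \<in> vecs 6" if "i < 6" for i
    using e_vecs k that by auto
  show "lin_indep 6 e"
    unfolding lin_indep_def zero_vec
  proof (intro allI impI)
    fix c :: "nat \<Rightarrow> 'a" and i :: nat
    assume z: "lin_comb 6 c e = 0" and i: "i < 6"
    have "bil f (e j) (lin_comb 6 c e) = 0" for j
      unfolding z by simp
    from this[of 0] this[of 1] this[of 2] this[of 3] this[of 4] this[of 5] show "c i = 0"
      using i by (auto simp: less_numeral lin_comb_numeral form_simps gram4 gram5[OF k4] gram6[OF k] gram_sym)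
  qed
qed

lemma frame4: "f2_frame f 4 e qplus_3_2_form"
proof -
  interpret f2_basis f 4 e by (rule basis4)
  show ?thesis
    by unfold_locales
      (simp_all only: f2_comb_def qplus_3_2_form_def emb_add emb_simps, simp_all add: lin_comb_numeral form_simps gram4 gram_sym algebra_simps)
qed

lemma frame5:
  assumes "4 \<le> k"
  shows "f2_frame f 5 e q_4_2_form"
proof -
  interpret f2_basis f 5 e by (rule basis5[OF assms])
  show ?thesis
    by unfold_locales
      (simp_all only: f2_comb_def q_4_2_form_def emb_add emb_simps, simp_all add: lin_comb_numeral form_simps gram4 gram5[OF assms] gram_sym algebra_simps)
qed

lemma frame6:
  assumes k: "5 \<le> k"
  shows "f2_frame f 6 e qminus_5_2_form"
proof -
  have k4: "4 \<le> k" using k by simp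
  interpret f2_basis f 6 e by (rule basis6[OF k])
  show ?thesis
    by unfold_locales
      (simp_all only: f2_comb_def qminus_5_2_form_def emb_add emb_simps, simp_all add: lin_comb_numeral form_simps gram4 gram5[OF k4] gram6[OF k]
        gram_sym algebra_simps)
qed

section \<open>The configuration as part of a quadric\<close>

definition config :: "(nat \<Rightarrow> 'a) set" where
  "config = y ` {..<k} \<union> (\<lambda>i. y i + u) ` {..<k}"

lemma config_f: "v \<in> config \<Longrightarrow> f v = 0"
  by (auto simp: config_def gram_simps)

lemma config_bil: "v \<in> config \<Longrightarrow> bil f u v = 1"
  by (auto simp: config_def gram_simps)

lemma config_vecs: "v \<in> config \<Longrightarrow> v \<in> vecs 6"
  by (auto simp: config_def y_vecs u_vecs)

text \<open>The pairs of \<open>y 0\<close> and \<open>y 1\<close> supply the points for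
  \<open>F2_subgeometry_mem\<close>. The third vector \<open>y 2\<close> serves to separate these
  points and to detect nonzero vectors.\<close>

lemma center_mem:
  assumes G: "F2_subgeometry 6 G" and sub: "pt ` config \<subseteq> G" and z: "pt (y 0 + y 1 + u) \<in> G"
  shows "pt u \<in> G"
proof (rule F2_subgeometry_mem[OF G])
  have k: "0 < k" "1 < k" "2 < k" using k3 by auto
  have ne: "pt (y i) \<noteq> pt (y j + u)" if ij: "i < 2" "j < 2" for i j
  proof
    assume eq: "pt (y i) = pt (y j + u)"
    have nz: "y j + u \<noteq> 0"
      using bil_uy[of j] ij k by (auto dest: arg_cong[of _ _ "bil f u"] simp: form_simps)
    obtain t where t: "y j + u = scale t (y i)"
      by (rule pt_eqE[OF eq nz])
    have "t = 1"
      using arg_cong[OF t, of "bil f u"] ij k by (simp add: gram_simps)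
    \<comment> \<open>Pairing with \<open>y 2\<close> gives \<open>1 + 1 = 0\<close> on the left and
      1 on the right.\<close>
    then show False
      using arg_cong[OF t, of "bil f (y 2)"] ij k by (simp add: gram_simps)
  qed
  show "pt (y 0) \<noteq> pt (y 1 + u)" "pt (y 1) \<noteq> pt (y 0 + u)"
    using ne[of 0 1] ne[of 1 0] by simp_all
  have "pt (y i) \<in> G" "pt (y i + u) \<in> G" if "i < k" for i
    using sub that unfolding config_def by blast+
  then show "{pt (y 0), pt (y 1), pt (y 0 + u), pt (y 1 + u), pt (y 0 + y 1 + u)} \<subseteq> G"
    using z k by simp
  \<comment> \<open>Pairing with \<open>u\<close> detects all the vectors except \<open>u\<close>
    and \<open>y 0 + y 1 + u\<close>, which are orthogonal to \<open>u\<close>; for these two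
    \<open>y 2\<close> is used.\<close>
  have nzI: "v \<noteq> 0" if "bil f w v \<noteq> 0" for v w
    using that by auto
  show "y 0 \<noteq> 0" "y 1 \<noteq> 0" "y 0 + u \<noteq> 0" "y 1 + u \<noteq> 0" "u \<noteq> 0" "y 0 + y 1 + u \<noteq> 0"
    by (rule nzI[of u] nzI[of "y 2"], simp add: gram_simps k)+
qed

text \<open>Leaves two checks for each case: the configuration lies among the 0/1-combinations of
  \<open>e\<close>, and each singular combination not orthogonal to \<open>u\<close> belongs to it.
  The other claims come from \<open>f2_frame\<close>, except for the center, which
  \<open>center_mem\<close> provides.\<close>

lemma config_quadric:
  assumes "f2_frame f m e g" and m: "4 \<le> m"
    and range: "config \<subseteq> range (f2_comb m e)"
    and enum: "\<And>c. c \<in> vecs m \<Longrightarrow> g c = 0 \<Longrightarrow> bil f u (f2_comb m e c) \<noteq> 0 \<Longrightarrow> f2_comb m e c \<in> config"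
  shows "\<exists>S \<subseteq> sing_pts 6 f. pt ` config = S - H0 \<and> is_F2_subgeometry_set 6 S \<and>
           geom_iso S (subgeom_lines 6 f S) (sing_pts m g) (qlines m g) \<and> pt u \<in> F2_span 6 S"
proof -
  interpret f2_frame f m e g by fact
  have "pt ` config \<subseteq> quadric"
  proof (rule image_subsetI)
    fix v assume v: "v \<in> config"
    then have "v \<noteq> 0"
      using config_bil[OF v] by auto
    then show "pt v \<in> quadric"
      using quadric_memI range config_f v by blast
  qed
  moreover have "pt ` config \<inter> H0 = {}"
  proof -
    have "pt v \<notin> H0" if v: "v \<in> config" for v
      using H0_iff[OF config_vecs[OF v]] config_bil[OF v] by fastforce
    then show ?thesis
      by blast
  qed
  moreover have "quadric - H0 \<subseteq> pt ` config"
  proof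
    fix P assume P: "P \<in> quadric - H0"
    then obtain c where c: "P = pt (Psi c)" "c \<in> vecs m" "c \<noteq> 0" "g c = 0"
      by (auto simp: quadric_def)
    then have "bil f u (Psi c) \<noteq> 0"
      using P H0_iff Psi_eq_0_iff by auto
    then show "P \<in> pt ` config"
      using enum c by blast
  qed
  ultimately have "pt ` config = quadric - H0"
    by blast
  moreover have "pt u \<in> F2_span 6 quadric"
    unfolding F2_span_def
  proof
    fix G assume "G \<in> {G. F2_subgeometry 6 G \<and> quadric \<subseteq> G}"
    then have G: "F2_subgeometry 6 G" "quadric \<subseteq> G"
      by auto
    \<comment> \<open>The vector \<open>e 2 = u + y 0 + y 1\<close> is singular and orthogonal to
      \<open>u\<close>, so it yields a point of the quadric inside \<open>H0\<close>: the extra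
      point that \<open>center_mem\<close> requires.\<close>
    have "e 2 \<noteq> 0"
      using gram4(10) by auto
    then have "pt (e 2) \<in> quadric"
      using quadric_memI range_f2_comb_unit[of 2 m e] gram4(3) m by simp
    then have "pt (y 0 + y 1 + u) \<in> G"
      using G by (auto simp: e_simps ac_simps)
    then show "pt u \<in> G"
      using center_mem[OF G(1)] \<open>pt ` config \<subseteq> quadric\<close> G(2) by blast
  qed
  ultimately show ?thesis
    using quadric_subset quadric_F2 quadric_iso by blast
qed

lemma f2_comb_5: "f2_comb 5 e c = f2_comb 4 e c + scale (emb (c 4)) (e 4)"
  by (simp add: f2_comb_def lin_comb_numeral(2))

lemma f2_comb_6: "f2_comb 6 e c = f2_comb 4 e c + scale (emb (c 4)) (e 4) + scale (emb (c 5)) (e 5)"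
  by (simp add: f2_comb_def lin_comb_numeral(2,3))

text \<open>The coefficient \<open>c 2\<close> is absent because \<open>e 2\<close> is orthogonal to
  \<open>u\<close>.\<close>

lemma bil_u_f2_comb: "bil f u (f2_comb 4 e c) = emb (c 0 + c 1 + c 3)"
  by (simp only: emb_add f2_comb_def lin_comb_numeral(1) form_simps gram4 mult_1_right mult_zero_right add_0_right)

lemma u_range: "4 \<le> m \<Longrightarrow> u \<in> range (f2_comb m e)"
proof -
  assume m: "4 \<le> m"
  have "e 0 + (e 1 + e 2) \<in> range (f2_comb m e)"
    using m by (intro range_f2_comb_add range_f2_comb_unit) auto
  moreover have "e 0 + (e 1 + e 2) = u"
    by (simp add: e_simps ac_simps)
  ultimately show ?thesis
    by (simp only:)
qed

text \<open>Together with \<open>u\<close>, the vectors \<open>y 0\<close> to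
  \<open>y (m - 2)\<close> make up \<open>m\<close> vectors, whence the index shift. Each is
  recovered by undoing the definition of \<open>e\<close>.\<close>

lemma y_range:
  assumes m: "4 \<le> m" and i: "i + 1 < m"
  shows "y i \<in> range (f2_comb m e)"
proof -
  have y01: "y 0 \<in> range (f2_comb m e)" "y 1 \<in> range (f2_comb m e)"
    using range_f2_comb_unit[of 0 m e] range_f2_comb_unit[of 1 m e] m by (auto simp: e_simps)
  have "u + e 3 \<in> range (f2_comb m e)"
    using m by (intro range_f2_comb_add range_f2_comb_unit u_range) auto
  then have y2: "y 2 \<in> range (f2_comb m e)"
    by (simp add: e_simps)
  show ?thesis
  proof (cases "i < 3")
    case True
    then show ?thesis
      using y01 y2 by (auto simp: less_numeral)
  next
    case False
    then have "e (i + 1) = y i + (u + y 0 + y 1 + y 2)"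
      by (simp add: e_def)
    then have "e (i + 1) + (u + y 0 + y 1 + y 2) = y i"
      by (simp add: add.assoc)
    moreover have "e (i + 1) + (u + y 0 + y 1 + y 2) \<in> range (f2_comb m e)"
      by (intro range_f2_comb_add range_f2_comb_unit i u_range m y01 y2)
    ultimately show ?thesis
      by (simp only:)
  qed
qed

lemma config_range:
  assumes m: "4 \<le> m" and y: "\<And>i. i < k \<Longrightarrow> y i \<in> range (f2_comb m e)"
  shows "config \<subseteq> range (f2_comb m e)"
  unfolding config_def using y range_f2_comb_add[OF y u_range[OF m]] by auto

lemma config_mem: "i < k \<Longrightarrow> y i \<in> config" "i < k \<Longrightarrow> y i + u \<in> config"
  by (auto simp: config_def)

lemma bit_eq_1: "b \<noteq> 0 \<Longrightarrow> b = (1 :: bit)"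
  by (cases b) simp_all

text \<open>The condition from \<open>u\<close> selects eight of the sixteen choices of four bits.
  Six of them are singular and give the first three pairs; the other two are treated in
  \<open>f2_comb_4_nonsingular\<close>.\<close>

lemma f2_comb_4_singular:
  assumes "bil f u (f2_comb 4 e c) \<noteq> 0" "qplus_3_2_form c = 0"
  shows "f2_comb 4 e c \<in> config"
proof -
  have "c 0 + c 1 + c 3 = 1"
    using assms(1) unfolding bil_u_f2_comb emb_eq_0_iff by (rule bit_eq_1)
  then have "f2_comb 4 e c \<in> {y 0, y 1, y 2, y 0 + u, y 1 + u, y 2 + u}"
    using assms(2) unfolding qplus_3_2_form_def f2_comb_def lin_comb_numeral(1)
    by (cases "c 0"; cases "c 1"; cases "c 2"; cases "c 3"; simp add: e_simps ac_simps)
  then show ?thesis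
    using config_mem[of 0] config_mem[of 1] config_mem[of 2] k3 by auto
qed

text \<open>Both vectors have form value 1. Adding \<open>e 4\<close> or \<open>e 5\<close>, which
  contain the first of them as a summand, makes them singular and leaves the next pair of the
  configuration.\<close>

lemma f2_comb_4_nonsingular:
  assumes "bil f u (f2_comb 4 e c) \<noteq> 0" "qplus_3_2_form c = 1"
  shows "f2_comb 4 e c \<in> {u + y 0 + y 1 + y 2, y 0 + y 1 + y 2}"
proof -
  have "c 0 + c 1 + c 3 = 1"
    using assms(1) unfolding bil_u_f2_comb emb_eq_0_iff by (rule bit_eq_1)
  then show ?thesis
    using assms(2) unfolding qplus_3_2_form_def f2_comb_def lin_comb_numeral(1)
    by (cases "c 0"; cases "c 1"; cases "c 2"; cases "c 3"; simp add: e_simps ac_simps)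
qed

section \<open>The three cases: hexagon, cube and dodecade\<close>

lemma hexagon:
  assumes k: "k = 3"
  shows "\<exists>S \<subseteq> sing_pts 6 f. pt ` config = S - H0 \<and> is_F2_subgeometry_set 6 S \<and>
    geom_iso S (subgeom_lines 6 f S) (sing_pts 4 qplus_3_2_form) (qlines 4 qplus_3_2_form) \<and> pt u \<in> F2_span 6 S"
proof (rule config_quadric)
  show "f2_frame f 4 e qplus_3_2_form" by (rule frame4)
  show "config \<subseteq> range (f2_comb 4 e)"
    using k by (intro config_range y_range) auto
qed (simp_all add: f2_comb_4_singular)

lemma cube:
  assumes k: "k = 4"
  shows "\<exists>S \<subseteq> sing_pts 6 f. pt ` config = S - H0 \<and> is_F2_subgeometry_set 6 S \<and>
    geom_iso S (subgeom_lines 6 f S) (sing_pts 5 q_4_2_form) (qlines 5 q_4_2_form) \<and> pt u \<in> F2_span 6 S"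
proof (rule config_quadric)
  have k': "4 \<le> k" using k by simp
  show "f2_frame f 5 e q_4_2_form" by (rule frame5[OF k'])
  show "config \<subseteq> range (f2_comb 5 e)"
    using k by (intro config_range y_range) auto
  fix c assume c: "q_4_2_form c = 0" "bil f u (f2_comb 5 e c) \<noteq> 0"
  \<comment> \<open>As \<open>e 4\<close> is orthogonal to \<open>u\<close>, only the first four
    coordinates count.\<close>
  then have u: "bil f u (f2_comb 4 e c) \<noteq> 0"
    by (simp add: f2_comb_5 form_simps gram5[OF k'])
  show "f2_comb 5 e c \<in> config"
  proof (cases "c 4")
    assume c4: "c 4 = 0"
    then have "qplus_3_2_form c = 0"
      using c(1) by (simp add: q_4_2_form_def qplus_3_2_form_def)
    then show ?thesis
      using f2_comb_4_singular[OF u] c4 by (simp add: f2_comb_5)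
  next
    assume c4: "c 4 = 1"
    then have "qplus_3_2_form c \<noteq> 0"
      using c(1) by (auto simp: q_4_2_form_def qplus_3_2_form_def)
    then have "f2_comb 4 e c \<in> {u + y 0 + y 1 + y 2, y 0 + y 1 + y 2}"
      by (intro f2_comb_4_nonsingular u bit_eq_1)
    \<comment> \<open>Adding \<open>e 4 = y 3 + (u + y 0 + y 1 + y 2)\<close> cancels
      \<open>y 0\<close>, \<open>y 1\<close> and \<open>y 2\<close>.\<close>
    then have "f2_comb 5 e c \<in> {y 3, y 3 + u}"
      using c4 by (auto simp: f2_comb_5 e_simps ac_simps)
    then show ?thesis
      using config_mem[of 3] k by auto
  qed
qed simp

text \<open>The radical of the Gram matrix of \<open>u, y 0, \<dots>, y 5\<close> is spanned by the all-one vector.\<close>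

lemma dodecade_relation:
  assumes k: "k = 6" and nd: "nondeg 6 f"
  shows "y 5 = u + (y 0 + (y 1 + (y 2 + (y 3 + y 4))))"
proof -
  have k': "5 \<le> k" using k by simp
  interpret f2_basis f 6 e by (rule basis6[OF k'])
  \<comment> \<open>Six independent vectors span: an injective map of the finite set
    \<open>vecs 6\<close> into itself is onto.\<close>
  have surj: "(\<lambda>c. lin_comb 6 c e) ` vecs 6 = vecs 6"
  proof (rule endo_inj_surj[OF finite_vecs])
    show "(\<lambda>c. lin_comb 6 c e) ` vecs 6 \<subseteq> vecs 6"
      using vecs_lin_comb[of 6 e] f2_basis.e_vecs[OF basis6[OF k']] by blast
    show "inj_on (\<lambda>c. lin_comb 6 c e) (vecs 6)"
      using lin_comb_inj vecs_eqI by (intro inj_onI) blast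
  qed
  define r where "r = y 5 + (u + (y 0 + (y 1 + (y 2 + (y 3 + y 4)))))"
  \<comment> \<open>Each of the seven vectors pairs to 1 with the six others and to 0 with itself,
    hence is orthogonal to their sum \<open>r\<close>; so is every \<open>e i\<close> used
    here.\<close>
  have "bil f r (e 0) = 0" "bil f r (e 1) = 0" "bil f r (e 2) = 0" "bil f r (e 3) = 0"
    "bil f r (e 4) = 0" "bil f r (e 5) = 0"
    using k by (simp_all add: r_def gram_simps)
  then have "bil f r (lin_comb 6 c e) = 0" for c
    by (simp add: lin_comb_numeral form_simps)
  then have "\<forall>v\<in>vecs 6. bil f r v = 0"
    using surj by (auto elim!: equalityE)
  moreover have "r \<in> vecs 6"
    unfolding r_def using k by (intro vecs_closed(2) u_vecs y_vecs) auto
  ultimately have "r = 0"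
    using nd unfolding nondeg_def zero_vec by blast
  have "y 5 = r + (u + (y 0 + (y 1 + (y 2 + (y 3 + y 4)))))"
    unfolding r_def by (simp add: add.assoc)
  then show ?thesis
    unfolding \<open>r = 0\<close> by simp
qed

lemma dodecade:
  assumes k: "k = 6" and nd: "nondeg 6 f"
  shows "\<exists>S \<subseteq> sing_pts 6 f. pt ` config = S - H0 \<and> is_F2_subgeometry_set 6 S \<and>
    geom_iso S (subgeom_lines 6 f S) (sing_pts 6 qminus_5_2_form) (qlines 6 qminus_5_2_form) \<and> pt u \<in> F2_span 6 S"
proof (rule config_quadric)
  have k': "5 \<le> k" using k by simp
  show "f2_frame f 6 e qminus_5_2_form" by (rule frame6[OF k'])
  have y: "y i \<in> range (f2_comb 6 e)" if "i < 5" for i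
    using y_range that by simp
  have "y 5 \<in> range (f2_comb 6 e)"
    unfolding dodecade_relation[OF k nd] by (intro range_f2_comb_add y u_range) auto
  then have "y i \<in> range (f2_comb 6 e)" if "i < k" for i
    using y that unfolding k less_numeral(4) by blast
  then show "config \<subseteq> range (f2_comb 6 e)"
    by (intro config_range) auto
  fix c assume c: "qminus_5_2_form c = 0" "bil f u (f2_comb 6 e c) \<noteq> 0"
  have k4: "4 \<le> k" using k by simp
  have u: "bil f u (f2_comb 4 e c) \<noteq> 0"
    using c(2) by (simp add: f2_comb_6 form_simps gram5[OF k4] gram6[OF k'])
  show "f2_comb 6 e c \<in> config"
  proof (cases "c 4 = 0 \<and> c 5 = 0")
    case True
    then have "qplus_3_2_form c = 0"
      using c(1) by (simp add: qminus_5_2_form_def qplus_3_2_form_def)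
    then show ?thesis
      using f2_comb_4_singular[OF u] True by (simp add: f2_comb_6)
  next
    case False
    \<comment> \<open>This binary form is anisotropic over the field with two elements, so the part
      in the first four coordinates must be nonsingular.\<close>
    then have "c 4 * c 4 + c 4 * c 5 + c 5 * c 5 = 1"
      by (cases "c 4"; cases "c 5"; simp)
    then have "qplus_3_2_form c + 1 = 0"
      using c(1) unfolding qminus_5_2_form_def qplus_3_2_form_def by (metis add.assoc)
    then have "qplus_3_2_form c \<noteq> 0"
      by auto
    then have w: "f2_comb 4 e c \<in> {u + y 0 + y 1 + y 2, y 0 + y 1 + y 2}"
      by (intro f2_comb_4_nonsingular u bit_eq_1)
    \<comment> \<open>The three nonzero choices give the pairs of \<open>y 3\<close>,
      \<open>y 4\<close> and \<open>y 5\<close>. In the last one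
      \<open>e 4 + e 5 = y 3 + y 4\<close>, and \<open>dodecade_relation\<close> turns the sum into
      \<open>y 5\<close> or \<open>y 5 + u\<close>.\<close>
    consider "c 4 = 1" "c 5 = 0" | "c 4 = 0" "c 5 = 1" | "c 4 = 1" "c 5 = 1"
      using False bit_eq_1 by blast
    then have "f2_comb 6 e c \<in> {y 3, y 3 + u, y 4, y 4 + u, y 5, y 5 + u}"
    proof cases
      case 1
      with w show ?thesis
        unfolding f2_comb_6 by (elim insertE emptyE) (simp_all add: e_simps ac_simps)
    next
      case 2
      with w show ?thesis
        unfolding f2_comb_6 by (elim insertE emptyE) (simp_all add: e_simps ac_simps)
    next
      case 3
      with w show ?thesis
        unfolding f2_comb_6 dodecade_relation[OF k nd]
        by (elim insertE emptyE) (simp_all add: e_simps ac_simps)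
    qed
    moreover have "3 < k" "4 < k" "5 < k"
      using k by simp_all
    ultimately show ?thesis
      by (elim insertE emptyE) (simp_all only: config_mem)
  qed
qed simp

end

section \<open>Normalising the center and choosing representatives\<close>

lemma char2_sqrt:
  fixes c :: "'a::{field, finite}"
  assumes "(1::'a) + 1 = 0"
  obtains r where "r * r = c"
proof -
  \<comment> \<open>Equal squares force \<open>x = y\<close> or \<open>x = - y\<close>, which
    coincide here; on a finite field an injective squaring map is onto.\<close>
  have "inj (\<lambda>x::'a. x * x)"
  proof (rule injI)
    fix x y :: 'a assume "x * x = y * y"
    moreover have "y + y = y * (1 + 1)"
      by (simp only: distrib_left mult_1_right)
    then have "y + y = 0"
      by (simp only: assms mult_zero_right)
    then have "y = - y"
      by (simp only: eq_neg_iff_add_eq_0)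
    ultimately show "x = y"
      by (metis square_eq_iff)
  qed
  then have "surj (\<lambda>x::'a. x * x)"
    using finite_UNIV_inj_surj finite by blast
  then obtain r where "c = r * r"
    by (rule surjE)
  then show thesis
    using that by blast
qed

context char2_form
begin

text \<open>The functional \<open>bil f u\<close> vanishes on the kernel of the functional defining
  \<open>H0\<close>. If it also vanished at a vector outside that kernel, it would be zero, against
  nondegeneracy.\<close>

lemma polar_hyperplane:
  assumes nd: "nondeg 6 f" and hyp: "hyperplane 6 H0"
    and u: "u \<in> vecs 6" "u \<noteq> 0" and n0: "{pt u} = (\<Inter>p\<in>H0. perp 6 f p)"
    and v: "v \<in> vecs 6" "v \<noteq> 0"
  shows "pt v \<in> H0 \<longleftrightarrow> bil f u v = 0"
proof -
  obtain a where H0: "H0 = {pt v | v. v \<in> vecs 6 \<and> v \<noteq> 0 \<and> (\<Sum>i<6. a i * v i) = 0}"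
    using hyp unfolding hyperplane_def zero_vec by blast
  define \<alpha> where "\<alpha> v = (\<Sum>i<6. a i * v i)" for v
  have \<alpha>_add: "\<alpha> (v + scale t w) = \<alpha> v + t * \<alpha> w" for v t w
    by (simp add: \<alpha>_def scale_def sum.distrib sum_distrib_left algebra_simps)
  have perp: "bil f u w = 0" if w: "w \<in> vecs 6" "w \<noteq> 0" "pt w \<in> H0" for w
  proof -
    have "pt u \<in> perp 6 f (pt w)"
      using n0 w(3) by blast
    then obtain v' u' where *: "pt v' = pt w" "pt u' = pt u" "bil f v' u' = 0"
      unfolding perp_def by force
    obtain s t where "w = scale s v'" "u = scale t u'"
      using pt_eqE[OF *(1) w(2)] pt_eqE[OF *(2) u(2)] by metis
    then show ?thesis
      using *(3) bil_sym[of u' v'] by (simp add: form_simps)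
  qed
  have kernel: "bil f u w = 0" if "w \<in> vecs 6" "\<alpha> w = 0" for w
  proof (cases "w = 0")
    case False
    then have "pt w \<in> H0"
      unfolding H0 using that \<alpha>_def by auto
    then show ?thesis
      using perp that False by blast
  qed simp
  show ?thesis
  proof
    assume "bil f u v = 0"
    have "\<alpha> v = 0"
    proof (rule ccontr)
      assume nz: "\<alpha> v \<noteq> 0"
      have "bil f u w = 0" if w: "w \<in> vecs 6" for w
      proof -
        \<comment> \<open>This multiple of \<open>v\<close> moves \<open>w\<close> into the kernel
          of \<open>\<alpha>\<close>.\<close>
        define t where "t = \<alpha> w / \<alpha> v"
        have "\<alpha> (w + scale t v) = 0"
          using nz by (simp add: \<alpha>_add t_def)
        then have "bil f u (w + scale t v) = 0"
          using kernel w v by simp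
        then show ?thesis
          using \<open>bil f u v = 0\<close> by (simp add: form_simps)
      qed
      then show False
        using nd u unfolding nondeg_def zero_vec by blast
    qed
    then show "pt v \<in> H0"
      unfolding H0 using v \<alpha>_def by auto
  qed (use perp v in blast)
qed

end

text \<open>Here \<open>f u = 1\<close> is not assumed: \<open>f u \<noteq> 0\<close> is first
  derived from a pair of points, and the rescaled vector then satisfies the same conditions.\<close>

locale polar_center = char2_form f for f :: "(nat \<Rightarrow> 'a::{field, finite}) \<Rightarrow> 'a" +
  fixes H0 :: "(nat \<Rightarrow> 'a) set set" and u :: "nat \<Rightarrow> 'a"
  assumes u_vecs: "u \<in> vecs 6" and u_nz: "u \<noteq> 0"
    and H0_iff: "\<And>v. v \<in> vecs 6 \<Longrightarrow> v \<noteq> 0 \<Longrightarrow> pt v \<in> H0 \<longleftrightarrow> bil f u v = 0"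
begin

lemma off_hyperplane:
  assumes "P \<in> sing_pts 6 f - H0"
  obtains p where "P = pt p" "p \<in> vecs 6" "p \<noteq> 0" "f p = 0" "bil f u p \<noteq> 0"
proof -
  obtain p where p: "P = pt p" "p \<in> vecs 6" "p \<noteq> 0" "f p = 0"
    using assms unfolding sing_pts_def zero_vec by blast
  then have "bil f u p \<noteq> 0"
    using assms H0_iff by blast
  then show thesis
    using that p by blast
qed

text \<open>Write \<open>u = scale a p + scale b q\<close>. Both points lie off \<open>H0\<close>,
  so \<open>a\<close>, \<open>b\<close> and \<open>bil f p q\<close> are nonzero, and
  \<open>f u\<close> is their product. The vector \<open>y\<close> is \<open>scale a p\<close>; in
  characteristic two \<open>y + u\<close> is then \<open>scale b q\<close>.\<close>

lemma center_pair:
  assumes x: "x0 \<in> sing_pts 6 f - H0" "x1 \<in> sing_pts 6 f - H0" "x0 \<noteq> x1"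
    and line: "\<And>l. l \<in> proj_lines 6 \<Longrightarrow> x0 \<in> l \<Longrightarrow> x1 \<in> l \<Longrightarrow> pt u \<in> l"
  shows "f u \<noteq> 0"
    and "f u = 1 \<Longrightarrow> \<exists>y. y \<in> vecs 6 \<and> f y = 0 \<and> bil f u y = 1 \<and> x0 = pt y \<and> x1 = pt (y + u)"
proof -
  obtain p where p: "x0 = pt p" "p \<in> vecs 6" "p \<noteq> 0" "f p = 0" "bil f u p \<noteq> 0"
    by (rule off_hyperplane[OF x(1)])
  obtain q where q: "x1 = pt q" "q \<in> vecs 6" "q \<noteq> 0" "f q = 0" "bil f u q \<noteq> 0"
    by (rule off_hyperplane[OF x(2)])
  have "indep2 p q"
    unfolding indep2_iff using p q x(3) by blast
  then have "line_through p q \<in> proj_lines 6"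
    unfolding proj_lines_eq using p q by blast
  then have "pt u \<in> line_through p q"
    using line p q by simp
  then obtain a b where "pt (scale a p + scale b q) = pt u"
    unfolding line_through_def by force
  then obtain c where "u = scale c (scale a p + scale b q)"
    using pt_eqE u_nz by metis
  then obtain a b where u: "u = scale a p + scale b q"
    by (auto simp: scale_add)
  have f_u: "f u = a * b * bil f p q"
    unfolding u by (simp add: form_simps p q)
  have bil_p: "bil f u p = b * bil f p q" and bil_q: "bil f u q = a * bil f p q"
    unfolding u using bil_sym[of q p] by (simp_all add: form_simps)
  have nz: "a \<noteq> 0" "b \<noteq> 0" "bil f p q \<noteq> 0"
    using p(5) q(5) bil_p bil_q by auto
  then show "f u \<noteq> 0"
    unfolding f_u by simp
  assume "f u = 1"
  then have one: "a * b * bil f p q = 1"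
    unfolding f_u .
  have "x0 = pt (scale a p)" "x1 = pt (scale b q)"
    using p q nz by simp_all
  moreover have "scale b q = scale a p + u"
    unfolding u by simp
  moreover have "bil f u (scale a p) = 1"
    using one by (simp add: form_simps bil_p mult.assoc)
  ultimately show "\<exists>y. y \<in> vecs 6 \<and> f y = 0 \<and> bil f u y = 1 \<and> x0 = pt y \<and> x1 = pt (y + u)"
    using p by (intro exI[of _ "scale a p"]) (simp add: f_scale)
qed

lemma config_vectors:
  assumes cc: "centric_config f H0 (pt u) k x" and f_u: "f u = 1"
  obtains y where "centric_vectors f H0 u k y" "config_set k x = pt ` centric_vectors.config u k y"
proof -
  have k: "3 \<le> k" and inj: "inj_on (\<lambda>(i, a). x i a) ({..<k} \<times> {..<2})"
    and sing: "\<And>i a. i < k \<Longrightarrow> a < 2 \<Longrightarrow> x i a \<in> sing_pts 6 f - H0"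
    and adj: "\<And>i a j b. i < k \<Longrightarrow> a < 2 \<Longrightarrow> j < k \<Longrightarrow> b < 2 \<Longrightarrow> i \<noteq> j \<Longrightarrow> a \<noteq> b \<Longrightarrow> hat_adj f H0 (x i a) (x j b)"
    and line: "\<And>i l. i < k \<Longrightarrow> l \<in> proj_lines 6 \<Longrightarrow> x i 0 \<in> l \<Longrightarrow> x i 1 \<in> l \<Longrightarrow> pt u \<in> l"
    using cc unfolding centric_config_def by simp_all
  have "\<exists>y. y \<in> vecs 6 \<and> f y = 0 \<and> bil f u y = 1 \<and> x i 0 = pt y \<and> x i 1 = pt (y + u)" if i: "i < k" for i
  proof (rule center_pair(2)[OF _ _ _ _ f_u])
    show "x i 0 \<noteq> x i 1"
      using inj_onD[OF inj, of "(i, 0)" "(i, 1)"] i by auto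
  qed (use sing line i in auto)
  then obtain y where y: "\<And>i. i < k \<Longrightarrow> y i \<in> vecs 6" "\<And>i. i < k \<Longrightarrow> f (y i) = 0"
      "\<And>i. i < k \<Longrightarrow> bil f u (y i) = 1" "\<And>i. i < k \<Longrightarrow> x i 0 = pt (y i)" "\<And>i. i < k \<Longrightarrow> x i 1 = pt (y i + u)"
    by metis
  have yy: "bil f (y i) (y j) = 1" if ij: "i < k" "j < k" "i \<noteq> j" for i j
  proof -
    have h: "hat_adj f H0 (x i 0) (x j 1)"
      using adj ij by simp
    then obtain l where l: "l \<in> qlines 6 f" "x i 0 \<in> l" "x j 1 \<in> l" and ne: "x i 0 \<noteq> x j 1"
      unfolding hat_adj_def by blast
    have "bil f u (y i) \<noteq> 0" "bil f u (y j + u) \<noteq> 0"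
      using y(3) ij by (simp_all add: form_simps)
    then have "y i \<noteq> 0" "y j + u \<noteq> 0"
      by auto
    \<comment> \<open>Adjacent points are orthogonal; since \<open>y i\<close> pairs to 1 with
      \<open>u\<close>, it must also pair to 1 with \<open>y j\<close>.\<close>
    then have "bil f (y i) (y j + u) = 0"
      using qline_bil(2)[OF l(1)] l ne y ij by simp
    then show ?thesis
      using y(3)[OF ij(1)] bil_sym[of u "y i"] by (simp add: form_simps eq_of_add_eq_0)
  qed
  have cv: "centric_vectors f H0 u k y"
    using k u_vecs f_u H0_iff y yy by unfold_locales auto
  interpret centric_vectors f H0 u k y by (rule cv)
  have "{..<k} \<times> {..<2} = (\<lambda>i. (i, 0)) ` {..<k} \<union> (\<lambda>i. (i, 1 :: nat)) ` {..<k}"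
    by (auto simp: less_2_cases_iff)
  then have "config_set k x = (\<lambda>i. x i 0) ` {..<k} \<union> (\<lambda>i. x i 1) ` {..<k}"
    unfolding config_set_def by (simp add: image_Un image_image)
  also have "\<dots> = pt ` config"
    unfolding config_def image_Un image_image using y(4,5) by simp
  finally show thesis
    using that cv by blast
qed

end

text \<open>An arbitrary representative \<open>w\<close> of the center is treated first, to obtain
  \<open>f w \<noteq> 0\<close>; dividing it by a square root of \<open>f w\<close> gives the
  normalised \<open>u\<close>.\<close>

lemma centric_config_vectors:
  fixes f :: "(nat \<Rightarrow> 'a::{field, finite}) \<Rightarrow> 'a"
  assumes char2: "(1::'a) + 1 = 0" and qf: "is_qform 6 f" and nd: "nondeg 6 f"
    and hyp: "hyperplane 6 H0"
    and n0: "n0 \<in> proj_points 6" "{n0} = (\<Inter>p\<in>H0. perp 6 f p)"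
    and cc: "centric_config f H0 n0 k x"
  obtains u y where "n0 = pt u" "centric_vectors f H0 u k y"
    "config_set k x = pt ` centric_vectors.config u k y"
proof -
  interpret char2_form f
    using char2 qf by unfold_locales
  obtain w where w: "n0 = pt w" "w \<in> vecs 6" "w \<noteq> 0"
    using n0(1) unfolding proj_points_def zero_vec by blast
  have H0: "pt v \<in> H0 \<longleftrightarrow> bil f w v = 0" if "v \<in> vecs 6" "v \<noteq> 0" for v
    using polar_hyperplane[OF nd hyp w(2,3)] n0(2) w(1) that by blast
  have "polar_center f H0 w"
    using w H0 by unfold_locales auto
  then have "f w \<noteq> 0"
  proof (rule polar_center.center_pair(1))
    show "x 0 0 \<in> sing_pts 6 f - H0" "x 0 1 \<in> sing_pts 6 f - H0"
      using cc unfolding centric_config_def by auto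
    have "inj_on (\<lambda>(i, a). x i a) ({..<k} \<times> {..<2})" "0 < k"
      using cc unfolding centric_config_def by auto
    then show "x 0 0 \<noteq> x 0 1"
      using inj_onD[of "\<lambda>(i, a). x i a" "{..<k} \<times> {..<2}" "(0, 0)" "(0, 1)"] by auto
    have "\<forall>i<k. \<forall>l\<in>proj_lines 6. x i 0 \<in> l \<and> x i 1 \<in> l \<longrightarrow> pt w \<in> l" "0 < k"
      using cc unfolding centric_config_def w(1) by auto
    then show "pt w \<in> l" if "l \<in> proj_lines 6" "x 0 0 \<in> l" "x 0 1 \<in> l" for l
      using that by blast
  qed
  obtain r where r: "r * r = f w"
    using char2_sqrt[OF char2] .
  define u where "u = scale (1 / r) w"
  have "r \<noteq> 0"
    using r \<open>f w \<noteq> 0\<close> by auto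
  then have u: "n0 = pt u" "u \<in> vecs 6" "u \<noteq> 0" "f u = 1"
    using w \<open>f w \<noteq> 0\<close> by (simp_all add: u_def f_scale r)
  have "pt v \<in> H0 \<longleftrightarrow> bil f u v = 0" if "v \<in> vecs 6" "v \<noteq> 0" for v
    using H0[OF that] \<open>r \<noteq> 0\<close> by (simp add: u_def form_simps)
  then have "polar_center f H0 u"
    using u by unfold_locales auto
  then obtain y where "centric_vectors f H0 u k y" "config_set k x = pt ` centric_vectors.config u k y"
    using polar_center.config_vectors[OF _ cc[unfolded u(1)] u(4)] by blast
  then show thesis
    using that u(1) by blast
qed

theorem theorem4:
  fixes f :: "(nat \<Rightarrow> 'a::{field, finite}) \<Rightarrow> 'a"
    and H0 :: "((nat \<Rightarrow> 'a) set) set"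
    and n0 :: "(nat \<Rightarrow> 'a) set"
  assumes char2: "(1::'a) + 1 = 0"
    and qf: "is_qform 6 f"
    and nd: "nondeg 6 f"
    and witt: "witt_index_2 6 f"
    and hyp: "hyperplane 6 H0"
    and parab: "geom_iso (sing_pts 6 f \<inter> H0) (subgeom_lines 6 f (sing_pts 6 f \<inter> H0))
                         (sing_pts 5 (parabolic_form :: (nat \<Rightarrow> 'a) \<Rightarrow> 'a))
                         (qlines 5 (parabolic_form :: (nat \<Rightarrow> 'a) \<Rightarrow> 'a))"
    and n0: "n0 \<in> proj_points 6" "{n0} = (\<Inter>p\<in>H0. perp 6 f p)"
  shows
    "(\<forall>x. centric_config f H0 n0 3 x \<longrightarrow>
        (\<exists>S \<subseteq> sing_pts 6 f. config_set 3 x = S - H0 \<and> is_F2_subgeometry_set 6 S \<and>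
           geom_iso S (subgeom_lines 6 f S) (sing_pts 4 qplus_3_2_form) (qlines 4 qplus_3_2_form) \<and>
           n0 \<in> F2_span 6 S))
   \<and> (\<forall>x. centric_config f H0 n0 4 x \<longrightarrow>
        (\<exists>S \<subseteq> sing_pts 6 f. config_set 4 x = S - H0 \<and> is_F2_subgeometry_set 6 S \<and>
           geom_iso S (subgeom_lines 6 f S) (sing_pts 5 q_4_2_form) (qlines 5 q_4_2_form) \<and>
           n0 \<in> F2_span 6 S))
   \<and> (\<forall>x. centric_config f H0 n0 6 x \<longrightarrow>
        (\<exists>S \<subseteq> sing_pts 6 f. config_set 6 x = S - H0 \<and> is_F2_subgeometry_set 6 S \<and>
           geom_iso S (subgeom_lines 6 f S) (sing_pts 6 qminus_5_2_form) (qlines 6 qminus_5_2_form) \<and>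
           n0 \<in> F2_span 6 S))"
proof (intro conjI allI impI)
  note vectors = centric_config_vectors[OF char2 qf nd hyp n0]
  show "\<exists>S \<subseteq> sing_pts 6 f. config_set 3 x = S - H0 \<and> is_F2_subgeometry_set 6 S \<and>
      geom_iso S (subgeom_lines 6 f S) (sing_pts 4 qplus_3_2_form) (qlines 4 qplus_3_2_form) \<and>
      n0 \<in> F2_span 6 S" if c: "centric_config f H0 n0 3 x" for x
  proof -
    obtain u y where v: "n0 = pt u" "centric_vectors f H0 u 3 y" "config_set 3 x = pt ` centric_vectors.config u 3 y"
      by (rule vectors[OF c])
    show ?thesis
      unfolding v(1,3) by (rule centric_vectors.hexagon[OF v(2) refl])
  qed
  show "\<exists>S \<subseteq> sing_pts 6 f. config_set 4 x = S - H0 \<and> is_F2_subgeometry_set 6 S \<and>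
      geom_iso S (subgeom_lines 6 f S) (sing_pts 5 q_4_2_form) (qlines 5 q_4_2_form) \<and>
      n0 \<in> F2_span 6 S" if c: "centric_config f H0 n0 4 x" for x
  proof -
    obtain u y where v: "n0 = pt u" "centric_vectors f H0 u 4 y" "config_set 4 x = pt ` centric_vectors.config u 4 y"
      by (rule vectors[OF c])
    show ?thesis
      unfolding v(1,3) by (rule centric_vectors.cube[OF v(2) refl])
  qed
  show "\<exists>S \<subseteq> sing_pts 6 f. config_set 6 x = S - H0 \<and> is_F2_subgeometry_set 6 S \<and>
      geom_iso S (subgeom_lines 6 f S) (sing_pts 6 qminus_5_2_form) (qlines 6 qminus_5_2_form) \<and>
      n0 \<in> F2_span 6 S" if c: "centric_config f H0 n0 6 x" for x
  proof -
    obtain u y where v: "n0 = pt u" "centric_vectors f H0 u 6 y" "config_set 6 x = pt ` centric_vectors.config u 6 y"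
      by (rule vectors[OF c])
    show ?thesis
      unfolding v(1,3) by (rule centric_vectors.dodecade[OF v(2) refl nd])
  qed
qed

end
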